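(* Let $n\ge 2$, $m\geq 1$, and let $M^n$ be an $n$-dimensional manifold isometrically immersed into a space form $N^{n+m}(c)$ of constant sectional curvature $c$. Let $h$ be the second fundamental form and let $H=\frac1n\,\mathrm{trace}\,h$ be the mean curvature tensor. Let $\rho$ and $\rho^\perp$ be the normalized scalar curvature of $M$ and the normalized scalar curvature of the normal bundle. Then at every point of $M$, $$\rho+\rho^\perp\le |H|^2+c .$$
   Context: Let $\{e_1,\dots,e_n\}$ be a local orthonormal frame of the tangent bundle and $\{\xi_1,\dots,\xi_m\}$ a local orthonormal frame of the normal bundle of the immersion. Let $R$ be the curvature tensor of the tangent bundle, with the sign convention that $R(e_i,e_j,e_j,e_i)$ is the sectional curvature of the plane spanned by $e_i,e_j$ ($i\neq j$), and let $R^\perp$ be the curvature tensor of the normal bundle. Then $$\rho=\frac{2}{n(n-1)}\sum_{1\le i<j\le n}R(e_i,e_j,e_j,e_i),$$ $$\rho^\perp=\frac{2}{n(n-1)}\Big(\sum_{1\le i<j\le n}\ \sum_{1\le r<s\le m}\langle R^\perp(e_i,e_j)\xi_r,\xi_s\rangle^2\Big)^{1/2}.$$ *)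

theory Defs
  imports "HOL-Analysis.Analysis"
begin

section \<open>Smooth maps between open subsets of Euclidean spaces\<close>

text \<open>On an open set \<open>S\<close> of a Euclidean space this is the usual class \<open>C\<^sup>k\<close>:
  all iterated directional derivatives up to order \<open>k\<close> exist as derivatives of Frechet
  differentiable maps and are continuous.\<close>

primrec Ck_on :: "nat \<Rightarrow> 'a set \<Rightarrow> ('a::real_normed_vector \<Rightarrow> 'b::real_normed_vector) \<Rightarrow> bool" where
  "Ck_on 0 S f \<longleftrightarrow> continuous_on S f"
| "Ck_on (Suc k) S f \<longleftrightarrow> (\<forall>x\<in>S. f differentiable (at x)) \<and>
      (\<forall>v. Ck_on k S (\<lambda>x. frechet_derivative f (at x) v))"

definition smooth_on :: "'a set \<Rightarrow> ('a::real_normed_vector \<Rightarrow> 'b::real_normed_vector) \<Rightarrow> bool" where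
  "smooth_on S f \<longleftrightarrow> (\<forall>k. Ck_on k S f)"

abbreviation deriv_at :: "('a::real_normed_vector \<Rightarrow> 'b::real_normed_vector) \<Rightarrow> 'a \<Rightarrow> 'a \<Rightarrow> 'b" where
  "deriv_at f x v \<equiv> frechet_derivative f (at x) v"


section \<open>Manifolds\<close>

text \<open>A chart is a pair of its domain and its coordinate map. The model space is a Euclidean
  space type, so that the dimension of the manifold is the \<open>DIM\<close> of that type.\<close>

type_synonym ('p, 'e) chart = "'p set \<times> ('p \<Rightarrow> 'e)"

abbreviation chart_dom :: "('p, 'e) chart \<Rightarrow> 'p set" where
  "chart_dom \<equiv> fst"

abbreviation chart_map :: "('p, 'e) chart \<Rightarrow> 'p \<Rightarrow> 'e" where
  "chart_map \<equiv> snd"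

definition chart_inv :: "('p, 'e) chart \<Rightarrow> 'e \<Rightarrow> 'p" where
  "chart_inv \<phi> = inv_into (chart_dom \<phi>) (chart_map \<phi>)"

definition is_chart :: "'p topology \<Rightarrow> ('p, 'e::euclidean_space) chart \<Rightarrow> bool" where
  "is_chart M \<phi> \<longleftrightarrow> openin M (chart_dom \<phi>) \<and> open (chart_map \<phi> ` chart_dom \<phi>) \<and>
     homeomorphic_map (subtopology M (chart_dom \<phi>)) (top_of_set (chart_map \<phi> ` chart_dom \<phi>)) (chart_map \<phi>)"

definition transition :: "('p, 'e) chart \<Rightarrow> ('p, 'e) chart \<Rightarrow> 'e \<Rightarrow> 'e" where
  "transition \<phi> \<phi>' = chart_map \<phi>' \<circ> chart_inv \<phi>"

locale smooth_manifold =
  fixes M :: "'p topology" and A :: "('p, 'e::euclidean_space) chart set"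
  assumes Hausdorff: "Hausdorff_space M"
    and second_countable: "second_countable M"
    and charts: "\<And>\<phi>. \<phi> \<in> A \<Longrightarrow> is_chart M \<phi>"
    and covers: "(\<Union>\<phi>\<in>A. chart_dom \<phi>) = topspace M"
    and smooth_transition: "\<And>\<phi> \<phi>'. \<phi> \<in> A \<Longrightarrow> \<phi>' \<in> A \<Longrightarrow>
      smooth_on (chart_map \<phi> ` (chart_dom \<phi> \<inter> chart_dom \<phi>')) (transition \<phi> \<phi>')"

text \<open>A Riemannian metric on an open subset of a Euclidean space assigns to each point a bilinear
  form. On a manifold it is given by its coordinate representations \<open>g \<phi>\<close> in the charts \<open>\<phi>\<close>,
  subject to the transformation law of a covariant 2-tensor.\<close>

type_synonym 'e metric = "'e \<Rightarrow> 'e \<Rightarrow> 'e \<Rightarrow> real"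

definition metric_on :: "'e set \<Rightarrow> ('e::euclidean_space) metric \<Rightarrow> bool" where
  "metric_on S g \<longleftrightarrow>
     (\<forall>u v. smooth_on S (\<lambda>x. g x u v)) \<and>
     (\<forall>x\<in>S. bilinear (g x) \<and> (\<forall>u v. g x u v = g x v u) \<and> (\<forall>u. u \<noteq> 0 \<longrightarrow> g x u u > 0))"

locale riemannian_manifold = smooth_manifold M A
  for M :: "'p topology" and A :: "('p, 'e::euclidean_space) chart set" +
  fixes g :: "('p, 'e) chart \<Rightarrow> 'e metric"
  assumes metric: "\<And>\<phi>. \<phi> \<in> A \<Longrightarrow> metric_on (chart_map \<phi> ` chart_dom \<phi>) (g \<phi>)"
    and metric_transform: "\<And>\<phi> \<phi>' p u v. \<phi> \<in> A \<Longrightarrow> \<phi>' \<in> A \<Longrightarrow> p \<in> chart_dom \<phi> \<inter> chart_dom \<phi>' \<Longrightarrow>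
      g \<phi> (chart_map \<phi> p) u v =
      g \<phi>' (chart_map \<phi>' p) (deriv_at (transition \<phi> \<phi>') (chart_map \<phi> p) u)
                            (deriv_at (transition \<phi> \<phi>') (chart_map \<phi> p) v)"


section \<open>Levi-Civita connection and curvature in coordinates\<close>

text \<open>\<open>christoffel g x u v\<close> is the vector with components \<open>\<Gamma>\<^sup>k\<^sub>i\<^sub>j u\<^sup>i v\<^sup>j\<close>: the Koszul formula for
  constant coordinate fields.\<close>

definition christoffel :: "('e::euclidean_space) metric \<Rightarrow> 'e \<Rightarrow> 'e \<Rightarrow> 'e \<Rightarrow> 'e" where
  "christoffel g x u v = (THE w. \<forall>z. g x w z =
     (deriv_at (\<lambda>y. g y v z) x u + deriv_at (\<lambda>y. g y u z) x v - deriv_at (\<lambda>y. g y u v) x z) / 2)"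

definition levi_civita ::
  "('e::euclidean_space) metric \<Rightarrow> ('e \<Rightarrow> 'e) \<Rightarrow> ('e \<Rightarrow> 'e) \<Rightarrow> 'e \<Rightarrow> 'e" where
  "levi_civita g X Y x = deriv_at Y x (X x) + christoffel g x (X x) (Y x)"

definition lie_bracket ::
  "('e::euclidean_space \<Rightarrow> 'e) \<Rightarrow> ('e \<Rightarrow> 'e) \<Rightarrow> 'e \<Rightarrow> 'e" where
  "lie_bracket X Y x = deriv_at Y x (X x) - deriv_at X x (Y x)"

definition curvature_op ::
  "('e::euclidean_space) metric \<Rightarrow> ('e \<Rightarrow> 'e) \<Rightarrow> ('e \<Rightarrow> 'e) \<Rightarrow> ('e \<Rightarrow> 'e) \<Rightarrow> 'e \<Rightarrow> 'e" where
  "curvature_op g X Y Z x =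
     levi_civita g X (levi_civita g Y Z) x - levi_civita g Y (levi_civita g X Z) x
     - levi_civita g (lie_bracket X Y) Z x"

definition curvature ::
  "('e::euclidean_space) metric \<Rightarrow> ('e \<Rightarrow> 'e) \<Rightarrow> ('e \<Rightarrow> 'e) \<Rightarrow> ('e \<Rightarrow> 'e) \<Rightarrow> ('e \<Rightarrow> 'e) \<Rightarrow> 'e \<Rightarrow> real" where
  "curvature g X Y Z W x = g x (curvature_op g X Y Z x) (W x)"

text \<open>Curvature is a tensor, so tangent vectors at a point may be extended by constant
  coordinate fields.\<close>

definition sectional_curvature :: "('e::euclidean_space) metric \<Rightarrow> 'e \<Rightarrow> 'e \<Rightarrow> 'e \<Rightarrow> real" where
  "sectional_curvature g x u v =
     curvature g (\<lambda>_. u) (\<lambda>_. v) (\<lambda>_. v) (\<lambda>_. u) x / (g x u u * g x v v - (g x u v)\<^sup>2)"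

text \<open>The term is used in the local sense: completeness and simple connectedness are not required.\<close>

locale space_form = riemannian_manifold N B G
  for N :: "'q topology" and B :: "('q, 'f::euclidean_space) chart set"
    and G :: "('q, 'f) chart \<Rightarrow> 'f metric" +
  fixes c :: real
  assumes constant_curvature: "\<And>\<psi> y u v. \<psi> \<in> B \<Longrightarrow> y \<in> chart_map \<psi> ` chart_dom \<psi> \<Longrightarrow>
      u \<noteq> v \<Longrightarrow> independent {u, v} \<Longrightarrow> sectional_curvature (G \<psi>) y u v = c"


section \<open>Isometric immersions\<close>

definition local_rep ::
  "('p, 'e) chart \<Rightarrow> ('q, 'f) chart \<Rightarrow> ('p \<Rightarrow> 'q) \<Rightarrow> 'e \<Rightarrow> 'f" where
  "local_rep \<phi> \<psi> f = chart_map \<psi> \<circ> f \<circ> chart_inv \<phi>"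

definition local_rep_dom ::
  "('p, 'e) chart \<Rightarrow> ('q, 'f) chart \<Rightarrow> ('p \<Rightarrow> 'q) \<Rightarrow> 'e set" where
  "local_rep_dom \<phi> \<psi> f = chart_map \<phi> ` {p \<in> chart_dom \<phi>. f p \<in> chart_dom \<psi>}"

locale isometric_immersion =
  source: riemannian_manifold M A g + target: riemannian_manifold N B G
  for M :: "'p topology" and A :: "('p, 'e::euclidean_space) chart set"
    and g :: "('p, 'e) chart \<Rightarrow> 'e metric"
    and N :: "'q topology" and B :: "('q, 'f::euclidean_space) chart set"
    and G :: "('q, 'f) chart \<Rightarrow> 'f metric" +
  fixes f :: "'p \<Rightarrow> 'q"
  assumes continuous: "continuous_map M N f"
    and smooth: "\<And>\<phi> \<psi>. \<phi> \<in> A \<Longrightarrow> \<psi> \<in> B \<Longrightarrow> smooth_on (local_rep_dom \<phi> \<psi> f) (local_rep \<phi> \<psi> f)"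
    and immersive: "\<And>\<phi> \<psi> x. \<phi> \<in> A \<Longrightarrow> \<psi> \<in> B \<Longrightarrow> x \<in> local_rep_dom \<phi> \<psi> f \<Longrightarrow>
      inj (deriv_at (local_rep \<phi> \<psi> f) x)"
    and isometric: "\<And>\<phi> \<psi> x u v. \<phi> \<in> A \<Longrightarrow> \<psi> \<in> B \<Longrightarrow> x \<in> local_rep_dom \<phi> \<psi> f \<Longrightarrow>
      g \<phi> x u v = G \<psi> (local_rep \<phi> \<psi> f x) (deriv_at (local_rep \<phi> \<psi> f) x u)
                                          (deriv_at (local_rep \<phi> \<psi> f) x v)"


section \<open>Second fundamental form and normal connection\<close>

text \<open>Here \<open>F\<close> is a coordinate representation of an immersion and \<open>G\<close> the ambient metric in the
  target chart. Vector fields along \<open>F\<close> are functions of the source coordinates;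
  \<open>pullback_connection G F X V\<close> is the derivative of \<open>V\<close> in the direction \<open>X\<close> with respect to the
  ambient Levi-Civita connection.\<close>

definition pullback_connection ::
  "('f::euclidean_space) metric \<Rightarrow> ('e::euclidean_space \<Rightarrow> 'f) \<Rightarrow> ('e \<Rightarrow> 'e) \<Rightarrow> ('e \<Rightarrow> 'f) \<Rightarrow> 'e \<Rightarrow> 'f" where
  "pullback_connection G F X V x =
     deriv_at V x (X x) + christoffel G (F x) (deriv_at F x (X x)) (V x)"

definition is_normal ::
  "('f::euclidean_space) metric \<Rightarrow> ('e::euclidean_space \<Rightarrow> 'f) \<Rightarrow> 'e \<Rightarrow> 'f \<Rightarrow> bool" where
  "is_normal G F x v \<longleftrightarrow> (\<forall>u. G (F x) v (deriv_at F x u) = 0)"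

definition normal_part ::
  "('f::euclidean_space) metric \<Rightarrow> ('e::euclidean_space \<Rightarrow> 'f) \<Rightarrow> 'e \<Rightarrow> 'f \<Rightarrow> 'f" where
  "normal_part G F x w = (THE v. is_normal G F x v \<and> w - v \<in> range (deriv_at F x))"

definition second_fundamental_form ::
  "('f::euclidean_space) metric \<Rightarrow> ('e::euclidean_space \<Rightarrow> 'f) \<Rightarrow> ('e \<Rightarrow> 'e) \<Rightarrow> ('e \<Rightarrow> 'e) \<Rightarrow> 'e \<Rightarrow> 'f" where
  "second_fundamental_form G F X Y x =
     normal_part G F x (pullback_connection G F X (\<lambda>y. deriv_at F y (Y y)) x)"

definition normal_connection ::
  "('f::euclidean_space) metric \<Rightarrow> ('e::euclidean_space \<Rightarrow> 'f) \<Rightarrow> ('e \<Rightarrow> 'e) \<Rightarrow> ('e \<Rightarrow> 'f) \<Rightarrow> 'e \<Rightarrow> 'f" where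
  "normal_connection G F X \<xi> x = normal_part G F x (pullback_connection G F X \<xi> x)"

definition normal_curvature_op ::
  "('f::euclidean_space) metric \<Rightarrow> ('e::euclidean_space \<Rightarrow> 'f) \<Rightarrow>
     ('e \<Rightarrow> 'e) \<Rightarrow> ('e \<Rightarrow> 'e) \<Rightarrow> ('e \<Rightarrow> 'f) \<Rightarrow> 'e \<Rightarrow> 'f" where
  "normal_curvature_op G F X Y \<xi> x =
     normal_connection G F X (normal_connection G F Y \<xi>) x
     - normal_connection G F Y (normal_connection G F X \<xi>) x
     - normal_connection G F (lie_bracket X Y) \<xi> x"


section \<open>Local frames and normalized scalar curvatures\<close>

definition tangent_frame_on ::
  "nat \<Rightarrow> 'e set \<Rightarrow> ('e::euclidean_space) metric \<Rightarrow> (nat \<Rightarrow> 'e \<Rightarrow> 'e) \<Rightarrow> bool" where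
  "tangent_frame_on n S g e \<longleftrightarrow>
     (\<forall>i\<in>{1..n}. smooth_on S (e i)) \<and>
     (\<forall>x\<in>S. \<forall>i\<in>{1..n}. \<forall>j\<in>{1..n}. g x (e i x) (e j x) = (if i = j then 1 else 0))"

definition normal_frame_on ::
  "nat \<Rightarrow> 'e set \<Rightarrow> ('f::euclidean_space) metric \<Rightarrow> ('e::euclidean_space \<Rightarrow> 'f) \<Rightarrow>
     (nat \<Rightarrow> 'e \<Rightarrow> 'f) \<Rightarrow> bool" where
  "normal_frame_on m S G F \<xi> \<longleftrightarrow>
     (\<forall>r\<in>{1..m}. smooth_on S (\<xi> r)) \<and>
     (\<forall>x\<in>S. \<forall>r\<in>{1..m}. is_normal G F x (\<xi> r x)) \<and>
     (\<forall>x\<in>S. \<forall>r\<in>{1..m}. \<forall>s\<in>{1..m}. G (F x) (\<xi> r x) (\<xi> s x) = (if r = s then 1 else 0))"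

definition mean_curvature ::
  "nat \<Rightarrow> ('f::euclidean_space) metric \<Rightarrow> ('e::euclidean_space \<Rightarrow> 'f) \<Rightarrow>
     (nat \<Rightarrow> 'e \<Rightarrow> 'e) \<Rightarrow> 'e \<Rightarrow> 'f" where
  "mean_curvature n G F e x =
     (1 / real n) *\<^sub>R (\<Sum>i\<in>{1..n}. second_fundamental_form G F (e i) (e i) x)"

definition norm_scalar_curvature ::
  "nat \<Rightarrow> ('e::euclidean_space) metric \<Rightarrow> (nat \<Rightarrow> 'e \<Rightarrow> 'e) \<Rightarrow> 'e \<Rightarrow> real" where
  "norm_scalar_curvature n g e x =
     2 / (real n * (real n - 1)) *
     (\<Sum>i\<in>{1..n}. \<Sum>j\<in>{i<..n}. curvature g (e i) (e j) (e j) (e i) x)"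

definition norm_normal_scalar_curvature ::
  "nat \<Rightarrow> nat \<Rightarrow> ('f::euclidean_space) metric \<Rightarrow> ('e::euclidean_space \<Rightarrow> 'f) \<Rightarrow>
     (nat \<Rightarrow> 'e \<Rightarrow> 'e) \<Rightarrow> (nat \<Rightarrow> 'e \<Rightarrow> 'f) \<Rightarrow> 'e \<Rightarrow> real" where
  "norm_normal_scalar_curvature n m G F e \<xi> x =
     2 / (real n * (real n - 1)) *
     sqrt (\<Sum>i\<in>{1..n}. \<Sum>j\<in>{i<..n}. \<Sum>r\<in>{1..m}. \<Sum>s\<in>{r<..m}.
       (G (F x) (normal_curvature_op G F (e i) (e j) (\<xi> r) x) (\<xi> s x))\<^sup>2)"

end

theory Submission imports Defs begin

text \<open>The inequality is pointwise, and at a point it is a statement about symmetric matrices.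

  Write \<open>h\<close> for the second fundamental form in the frame \<open>e\<close>, \<open>H\<close> for the mean curvature and
  \<open>B\<^sub>r\<close> for the traceless parts of the matrices \<open>\<langle>h(e\<^sub>i, e\<^sub>j), \<xi>\<^sub>r\<rangle>\<close>. The Gauss equation
  (\<open>gauss_equation\<close>) expresses the tangential curvature through \<open>c\<close> and \<open>h\<close>, which gives
  \<open>\<rho> \<le> c + |H|\<^sup>2 - \<Sum>\<^sub>r |B\<^sub>r|\<^sup>2 / (n (n - 1))\<close>. In a space form the ambient term of the Ricci equation
  (\<open>ricci_equation\<close>) vanishes, so that the components of the normal curvature are the entries of
  the commutators \<open>[B\<^sub>r, B\<^sub>s]\<close>; multiples of the identity commute with everything, which is why only
  the traceless parts enter. What remains is the matrix inequality
  \<open>\<Sum>\<^sub>r\<^sub>s |[B\<^sub>r, B\<^sub>s]|\<^sup>2 \<le> (\<Sum>\<^sub>r |B\<^sub>r|\<^sup>2)\<^sup>2\<close>, conjectured by De Smet, Dillen, Verstraelen and Vrancken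
  and proved by Lu and by Ge and Tang (\<open>commutator_energy_le\<close>).

  The matrix inequality is proved by a variation at a maximizer, close to Lu's argument. Both
  sides are homogeneous of degree four, so it suffices to bound the maximum of the left-hand side over
  symmetric tuples \<open>A\<close> with \<open>\<Sum>\<^sub>r |A\<^sub>r|\<^sup>2 = 1\<close>. At a maximizing tuple, let \<open>E\<close> be a symmetric unit
  matrix that maximizes \<open>\<Sum>\<^sub>r \<langle>A\<^sub>r, E\<rangle>\<^sup>2\<close>, with maximum \<open>b\<close>. Stretching the tuple in the direction
  \<open>E\<close> and using stationarity shows that the maximum equals \<open>\<Sum>\<^sub>r |[E, A\<^sub>r]|\<^sup>2\<close>
  (\<open>energy_maximizer_stationary\<close>). In an eigenbasis of \<open>E\<close>, with eigenvalues \<open>l\<^sub>i\<close>, this sum is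
  \<open>\<Sum>\<^sub>i\<^sub>j (l\<^sub>i - l\<^sub>j)\<^sup>2 c\<^sub>i\<^sub>j\<close>, where the \<open>c\<^sub>i\<^sub>j\<close> sum to 1, the diagonal ones contribute at least \<open>b\<close>, and
  the others are at most \<open>b / 2\<close>. Since \<open>\<Sum> l\<^sub>i\<^sup>2 = 1\<close>, the total excess of the factors
  \<open>(l\<^sub>i - l\<^sub>j)\<^sup>2\<close> over 1 is at most 2 (\<open>spread_excess\<close>), and the sum is at most
  \<open>(1 - b) + 2 \<cdot> b / 2 = 1\<close> (\<open>commutator_sum_bound\<close>).

  The geometric part works in one pair of charts. All fields live on an open set of the source
  coordinates, and everything rests on two facts about the connection \<open>nabla\<close> along the immersion: it
  is metric (\<open>metric_along_derivative\<close>) and its curvature is the ambient one (\<open>nabla_curvature\<close>).\<close>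


section \<open>Spectral theorem for self-adjoint operators\<close>

lemma linear_term_zero:
  fixes a K :: real
  assumes le: "\<And>t. 2 * t * a \<le> t\<^sup>2 * K"
  shows "a = 0"
proof (rule ccontr)
  assume a: "a \<noteq> 0"
  let ?t = "a / (\<bar>K\<bar> + 1)"
  have "2 * ?t * a \<le> ?t\<^sup>2 * (\<bar>K\<bar> + 1)"
    by (rule order.trans[OF le]) (intro mult_left_mono; simp)
  also have "\<dots> = ?t * a" by (simp add: power2_eq_square)
  finally have "?t * a \<le> 0" by simp
  moreover have "?t * a = a\<^sup>2 / (\<bar>K\<bar> + 1)" by (simp add: power2_eq_square)
  moreover have "a\<^sup>2 / (\<bar>K\<bar> + 1) > 0" using a by (intro divide_pos_pos) auto
  ultimately show False by linarith
qed

text \<open>The maximum of the Rayleigh quotient on an invariant subspace is an eigenvalue: otherwise moving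
  the maximizer \<open>v\<close> towards the component of \<open>T v\<close> orthogonal to \<open>v\<close> would increase the quotient to first
  order. The lemma serves twice, for the eigenbasis of a matrix and, on the space of symmetric
  matrices, for the choice of the direction in which a tuple of matrices is varied.\<close>

lemma rayleigh_maximizer:
  fixes T :: "'a::euclidean_space \<Rightarrow> 'a"
  assumes lin: "linear T" and sa: "\<And>x y. T x \<bullet> y = x \<bullet> T y"
    and sub: "subspace V" and inv: "T ` V \<subseteq> V" and ne: "V \<noteq> {0}"
  obtains v l where "v \<in> V" "norm v = 1" "T v = l *\<^sub>R v" "\<And>w. w \<in> V \<Longrightarrow> w \<bullet> T w \<le> l * (w \<bullet> w)"
proof -
  define S where "S = V \<inter> sphere 0 1"
  have cS: "compact S"
    unfolding S_def using closed_subspace[OF sub] by (intro closed_Int_compact) auto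
  obtain v0 where v0: "v0 \<in> V" "v0 \<noteq> 0"
    using ne subspace_0[OF sub] by auto
  have "(1 / norm v0) *\<^sub>R v0 \<in> S"
    unfolding S_def using v0 subspace_scale[OF sub] by auto
  then have "S \<noteq> {}" by auto
  moreover have "continuous_on S (\<lambda>v. v \<bullet> T v)"
    by (intro continuous_intros linear_continuous_on_compose[OF _ lin])
  ultimately obtain v where v: "v \<in> S" and vmax: "\<And>w. w \<in> S \<Longrightarrow> w \<bullet> T w \<le> v \<bullet> T v"
    using continuous_attains_sup[OF cS, of "\<lambda>v. v \<bullet> T v"] by blast
  define l where "l = v \<bullet> T v"
  have vV: "v \<in> V" and nv: "norm v = 1" using v by (auto simp: S_def)
  have vv: "v \<bullet> v = 1" using nv by (simp add: dot_square_norm)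
  have bound: "w \<bullet> T w \<le> l * (w \<bullet> w)" if w: "w \<in> V" for w
  proof (cases "w = 0")
    case False
    let ?u = "(1 / norm w) *\<^sub>R w"
    have "?u \<in> S" unfolding S_def using w False subspace_scale[OF sub] by auto
    from vmax[OF this] have "?u \<bullet> T ?u \<le> l" unfolding l_def .
    moreover have "?u \<bullet> T ?u = (w \<bullet> T w) / (w \<bullet> w)"
      by (simp add: linear_scale[OF lin] dot_square_norm power2_eq_square)
    ultimately have "(w \<bullet> T w) / (w \<bullet> w) \<le> l" by metis
    moreover have "w \<bullet> w > 0" using False by simp
    ultimately show ?thesis by (simp add: divide_le_eq)
  qed (simp add: linear_0[OF lin])
  have ortho: "T v \<bullet> w = 0" if w: "w \<in> V" "v \<bullet> w = 0" for w
  proof -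
    let ?a = "T v \<bullet> w" and ?K = "l * (w \<bullet> w) - w \<bullet> T w"
    have *: "2 * t * ?a \<le> t\<^sup>2 * ?K" for t
    proof -
      have "v + t *\<^sub>R w \<in> V" using vV w subspace_add[OF sub] subspace_scale[OF sub] by auto
      from bound[OF this]
      moreover have "(v + t *\<^sub>R w) \<bullet> T (v + t *\<^sub>R w) = l + 2 * t * ?a + t\<^sup>2 * (w \<bullet> T w)"
      proof -
        have "v \<bullet> T w = ?a" "w \<bullet> T v = ?a" using sa by (simp_all add: inner_commute)
        then show ?thesis
          by (simp add: linear_add[OF lin] linear_scale[OF lin] inner_add_left inner_add_right
            l_def power2_eq_square distrib_left)
      qed
      moreover have "(v + t *\<^sub>R w) \<bullet> (v + t *\<^sub>R w) = 1 + t\<^sup>2 * (w \<bullet> w)"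
        using w(2) vv by (simp add: inner_add_left inner_add_right inner_commute power2_eq_square)
      ultimately have "l + 2 * t * ?a + t\<^sup>2 * (w \<bullet> T w) \<le> l * (1 + t\<^sup>2 * (w \<bullet> w))" by simp
      then show ?thesis by (simp add: algebra_simps)
    qed
    from linear_term_zero[OF *] show ?thesis .
  qed
  let ?w = "T v - l *\<^sub>R v"
  have wV: "?w \<in> V" using vV inv by (intro subspace_diff[OF sub] subspace_scale[OF sub]) auto
  have vw: "v \<bullet> ?w = 0" using vv by (simp add: inner_diff_right l_def)
  have "?w \<bullet> ?w = 0" using ortho[OF wV vw] vw by (simp add: inner_diff_left)
  then have "T v = l *\<^sub>R v" by simp
  then show ?thesis using that[OF vV nv _ bound] by simp
qed

text \<open>Induction on the dimension: the orthogonal complement of an eigenvector in an invariant subspace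
  is again invariant.\<close>

lemma self_adjoint_eigenbasis:
  fixes T :: "'a::euclidean_space \<Rightarrow> 'a"
  assumes lin: "linear T" and sa: "\<And>x y. T x \<bullet> y = x \<bullet> T y"
  shows "subspace V \<Longrightarrow> T ` V \<subseteq> V \<Longrightarrow>
    \<exists>B. finite B \<and> card B = dim V \<and> B \<subseteq> V \<and> pairwise orthogonal B \<and>
        (\<forall>b\<in>B. norm b = 1 \<and> (\<exists>l. T b = l *\<^sub>R b))"
proof (induction "dim V" arbitrary: V)
  case 0
  then show ?case by (intro exI[of _ "{}"]) auto
next
  case (Suc k)
  have "V \<noteq> {0}" using Suc(2) by auto
  then obtain v l where v: "v \<in> V" "norm v = 1" "T v = l *\<^sub>R v"
    by (rule rayleigh_maximizer[OF lin sa Suc(3,4)]) blast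
  define V' where "V' = {x \<in> V. v \<bullet> x = 0}"
  have sub': "subspace V'"
    using subspace_inter[OF Suc(3) subspace_hyperplane[of v]] by (simp add: V'_def Collect_conj_eq)
  have inv': "T ` V' \<subseteq> V'"
    using Suc(4) by (auto simp: V'_def sa[of v, symmetric] v(3))
  have d: "dim V' + 1 = dim V"
  proof -
    have "{y \<in> V. \<forall>x \<in> span {v}. orthogonal x y} = V'"
      unfolding V'_def span_singleton orthogonal_def by (auto dest: spec[of _ "v"])
    moreover have "dim {y \<in> V. \<forall>x \<in> span {v}. orthogonal x y} + dim (span {v}) = dim V"
      using dim_subspace_orthogonal_to_vectors[OF subspace_span Suc(3), of "{v}"] v(1) Suc(3)
      by (simp add: span_minimal)
    moreover have "dim (span {v}) = 1" using v(2) by (simp add: dim_singleton) auto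
    ultimately show ?thesis by simp
  qed
  then have "k = dim V'" using Suc(2) by simp
  from Suc(1)[OF this sub' inv'] obtain B where B: "finite B" "card B = dim V'" "B \<subseteq> V'"
    "pairwise orthogonal B" "\<forall>b\<in>B. norm b = 1 \<and> (\<exists>l. T b = l *\<^sub>R b)" by blast
  have "v \<notin> B" using B(3) v(2) by (auto simp: V'_def dot_square_norm)
  moreover have "pairwise orthogonal (insert v B)"
    using B(3,4) by (auto simp: pairwise_insert V'_def orthogonal_def inner_commute)
  ultimately show ?case
    using B v d by (intro exI[of _ "insert v B"]) (auto simp: V'_def)
qed

lemma symmetric_matrix_eigenbasis:
  fixes E :: "real^'n^'n"
  assumes sym: "transpose E = E"
  obtains u :: "'n \<Rightarrow> real^'n" and l :: "'n \<Rightarrow> real"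
  where "\<And>i j. u i \<bullet> u j = (if i = j then 1 else 0)" "\<And>i. E *v u i = l i *\<^sub>R u i"
proof -
  have sa: "(E *v x) \<bullet> y = x \<bullet> (E *v y)" for x y
    by (metis dot_lmul_matrix inner_commute sym transpose_matrix_vector)
  obtain B where B: "finite B" "card B = dim (UNIV :: (real^'n) set)" "pairwise orthogonal B"
    "\<forall>b\<in>B. norm b = 1 \<and> (\<exists>l. E *v b = l *\<^sub>R b)"
    using self_adjoint_eigenbasis[OF matrix_vector_mul_linear[of E] sa subspace_UNIV] by auto
  have "card B = card (UNIV :: 'n set)" using B(2) by simp
  then obtain u where u: "bij_betw u (UNIV :: 'n set) B"
    using finite_same_card_bij[of "UNIV :: 'n set" B] B(1) by auto
  have uB: "u i \<in> B" for i using u by (auto simp: bij_betw_def)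
  have inj: "u i = u j \<longleftrightarrow> i = j" for i j using u by (auto simp: bij_betw_def inj_def)
  have "u i \<bullet> u j = (if i = j then 1 else 0)" for i j
    using B(3) B(4) uB[of i] uB[of j] inj[of i j]
    by (auto simp: pairwise_def orthogonal_def dot_square_norm)
  moreover have "\<forall>i. \<exists>l. E *v u i = l *\<^sub>R u i" using B(4) uB by blast
  from choice[OF this] obtain l where "\<forall>i. E *v u i = l i *\<^sub>R u i" ..
  ultimately show ?thesis by (intro that) auto
qed

section \<open>The total excess of squared eigenvalue gaps\<close>

text \<open>Expand the squares and use \<open>- 2 l\<^sub>i s \<le> l\<^sub>i\<^sup>2 + s\<^sup>2\<close> for \<open>s = \<Sum>\<^sub>j l\<^sub>j\<close>, then Cauchy-Schwarz for \<open>s\<^sup>2\<close>. With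
  \<open>k = card J\<close> the total becomes at most \<open>(k + 1) \<cdot> 1 - k\<close>.\<close>

lemma star_excess:
  fixes l :: "'n \<Rightarrow> real"
  assumes J: "finite J" "i \<notin> J" and S: "(\<Sum>j\<in>insert i J. (l j)\<^sup>2) \<le> 1"
  shows "(\<Sum>j\<in>J. (l i - l j)\<^sup>2 - 1) \<le> 1"
proof -
  let ?k = "real (card J)" and ?q = "\<Sum>j\<in>J. (l j)\<^sup>2" and ?s = "\<Sum>j\<in>J. l j"
  have pq: "(l i)\<^sup>2 + ?q \<le> 1" using S J by simp
  have "(\<Sum>j\<in>J. (l i - l j)\<^sup>2 - 1) = ?k * (l i)\<^sup>2 - 2 * l i * ?s + ?q - ?k"
    by (simp add: power2_diff sum.distrib sum_subtractf sum_distrib_left sum_distrib_right algebra_simps)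
  also have "- 2 * l i * ?s \<le> (l i)\<^sup>2 + ?s\<^sup>2"
    using zero_le_power2[of "l i + ?s"] unfolding power2_sum by linarith
  then have "?k * (l i)\<^sup>2 - 2 * l i * ?s + ?q - ?k \<le> ?k * (l i)\<^sup>2 + ((l i)\<^sup>2 + ?s\<^sup>2) + ?q - ?k"
    by linarith
  also have "?s\<^sup>2 \<le> ?q * ?k" by (rule sum_squared_le_sum_of_squares)
  then have "?k * (l i)\<^sup>2 + ((l i)\<^sup>2 + ?s\<^sup>2) + ?q - ?k \<le> (?k + 1) * ((l i)\<^sup>2 + ?q) - ?k"
    by (simp add: algebra_simps)
  also have "\<dots> \<le> 1"
    using mult_left_mono[OF pq, of "?k + 1"] by (simp only: mult_1_right) linarith
  finally show ?thesis .
qed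

text \<open>Call a pair far if the gap is greater than 1. Two disjoint far pairs, or three
  mutually far indices, would force \<open>\<Sum> l\<^sub>i\<^sup>2 > 1\<close>. Hence all far pairs share one index, and the bound for
  a star applies; the value 2 instead of 1 arises because every pair is counted in both orders.\<close>

lemma spread_excess:
  fixes l :: "'n::finite \<Rightarrow> real"
  assumes S: "(\<Sum>i\<in>UNIV. (l i)\<^sup>2) \<le> 1"
  shows "(\<Sum>i\<in>UNIV. \<Sum>j\<in>UNIV. max 0 ((l i - l j)\<^sup>2 - 1)) \<le> 2"
proof -
  define w where "w i j = max 0 ((l i - l j)\<^sup>2 - 1)" for i j
  define far where "far i j \<longleftrightarrow> (l i - l j)\<^sup>2 > 1" for i j
  have w0: "\<not> far i j \<Longrightarrow> w i j = 0" and wf: "far i j \<Longrightarrow> w i j = (l i - l j)\<^sup>2 - 1" for i j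
    by (auto simp: w_def far_def)
  have fsym: "far i j \<longleftrightarrow> far j i" for i j by (simp add: far_def power2_commute)
  have firr: "\<not> far i i" for i by (simp add: far_def)
  have wsym: "w i j = w j i" for i j by (simp add: w_def power2_commute)
  have sub: "(\<Sum>i\<in>I. (l i)\<^sup>2) \<le> 1" for I
    using sum_mono2[of UNIV I "\<lambda>i. (l i)\<^sup>2"] S by simp
  have disj: False if "far a b" "far c d" "distinct [a, b, c, d]" for a b c d
  proof -
    have "(l a)\<^sup>2 + (l b)\<^sup>2 + (l c)\<^sup>2 + (l d)\<^sup>2 \<le> 1" using sub[of "{a,b,c,d}"] that(3) by simp
    moreover have "(l a - l b)\<^sup>2 \<le> 2 * ((l a)\<^sup>2 + (l b)\<^sup>2)" "(l c - l d)\<^sup>2 \<le> 2 * ((l c)\<^sup>2 + (l d)\<^sup>2)"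
      using zero_le_power2[of "l a + l b"] zero_le_power2[of "l c + l d"]
      unfolding power2_sum power2_diff by (simp_all add: algebra_simps)
    ultimately show False using that(1,2) by (simp add: far_def)
  qed
  have tri: False if "far a b" "far b c" "far a c" for a b c
  proof -
    have "distinct [a, b, c]" using that firr by auto
    then have "(l a)\<^sup>2 + (l b)\<^sup>2 + (l c)\<^sup>2 \<le> 1" using sub[of "{a,b,c}"] by simp
    moreover have "(l a - l b)\<^sup>2 + (l b - l c)\<^sup>2 + (l a - l c)\<^sup>2 + (l a + l b + l c)\<^sup>2
        = 3 * ((l a)\<^sup>2 + (l b)\<^sup>2 + (l c)\<^sup>2)"
      by (simp add: power2_eq_square algebra_simps)
    moreover have "(l a + l b + l c)\<^sup>2 \<ge> 0" by simp
    moreover have "A + B + C \<le> 3" if "S \<le> 1" "A + B + C + D = 3 * S" "0 \<le> D" for A B C D S :: real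
      using that by linarith
    ultimately have "(l a - l b)\<^sup>2 + (l b - l c)\<^sup>2 + (l a - l c)\<^sup>2 \<le> 3" by blast
    moreover have "(l a - l b)\<^sup>2 + (l b - l c)\<^sup>2 + (l a - l c)\<^sup>2 > 1 + 1 + 1"
      by (intro add_strict_mono) (use that in \<open>simp_all add: far_def\<close>)
    ultimately show False by simp
  qed
  \<comment> \<open>If neither end of a far pair \<open>a, b\<close> is a common index, there are further far pairs at \<open>a\<close> and at
    \<open>b\<close>, which are disjoint or close up to a triangle.\<close>
  have "\<exists>c. \<forall>i j. far i j \<longrightarrow> i = c \<or> j = c"
  proof (rule ccontr)
    assume no: "\<nexists>c. \<forall>i j. far i j \<longrightarrow> i = c \<or> j = c"
    then obtain a b where ab: "far a b" by blast
    from no obtain i j where ij: "far i j" "i \<noteq> a" "j \<noteq> a" by blast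
    have "\<exists>d. far b d \<and> d \<noteq> a"
      using ij disj[of a b i j] ab fsym[of i b] firr by (cases "i = b"; cases "j = b") auto
    then obtain d where d: "far b d" "d \<noteq> a" by blast
    from no obtain i' j' where ij': "far i' j'" "i' \<noteq> b" "j' \<noteq> b" by blast
    have "\<exists>c. far a c \<and> c \<noteq> b"
      using ij' disj[of a b i' j'] ab fsym[of i' a] firr by (cases "i' = a"; cases "j' = a") auto
    then obtain c where c: "far a c" "c \<noteq> b" by blast
    show False
    proof (cases "c = d")
      case True
      then show ?thesis using tri[of a b c] ab c d by simp
    next
      case False
      have "a \<noteq> b" "c \<noteq> a" "d \<noteq> b" using ab c d firr by auto
      then show ?thesis using disj[of a c b d] c d False by auto
    qed
  qed
  then obtain c where c: "\<And>i j. far i j \<Longrightarrow> i = c \<or> j = c" by blast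
  have row: "(\<Sum>j\<in>UNIV. w c j) \<le> 1"
  proof -
    have "(\<Sum>j\<in>UNIV. w c j) = (\<Sum>j\<in>{j. far c j}. w c j)"
      by (rule sum.mono_neutral_right) (auto simp: w0)
    also have "\<dots> = (\<Sum>j\<in>{j. far c j}. (l c - l j)\<^sup>2 - 1)"
      by (rule sum.cong) (auto simp: wf)
    also have "\<dots> \<le> 1" by (rule star_excess[OF _ _ sub]) (use firr in auto)
    finally show ?thesis .
  qed
  have "(\<Sum>i\<in>UNIV. \<Sum>j\<in>UNIV. w i j)
      \<le> (\<Sum>i\<in>UNIV. \<Sum>j\<in>UNIV. (if i = c then w c j else 0) + (if j = c then w c i else 0))"
  proof (intro sum_mono)
    fix i j
    have wnn: "w x y \<ge> 0" for x y by (simp add: w_def)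
    show "w i j \<le> (if i = c then w c j else 0) + (if j = c then w c i else 0)"
    proof (cases "far i j")
      case True
      from c[OF this] show ?thesis using wnn wsym[of i j] by auto
    qed (use w0 wnn in auto)
  qed
  also have "\<dots> = (\<Sum>j\<in>UNIV. w c j) + (\<Sum>i\<in>UNIV. w c i)"
  proof -
    have "(\<Sum>i\<in>UNIV. \<Sum>j\<in>UNIV. (if i = c then w c j else 0)) = (\<Sum>j\<in>UNIV. w c j)"
      by (subst sum.swap) simp
    then show ?thesis by (simp add: sum.distrib)
  qed
  also have "\<dots> \<le> 2" using row by simp
  finally show ?thesis by (simp add: w_def)
qed

section \<open>Commutators and the Frobenius inner product\<close>

definition commutator :: "real^'n^'n \<Rightarrow> real^'n^'n \<Rightarrow> real^'n^'n" where
  "commutator X Y = X ** Y - Y ** X"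

lemma matrix_mult_linear:
  fixes A B C :: "real^'n^'n"
  shows "(A + B) ** C = A ** C + B ** C" "C ** (A + B) = C ** A + C ** B"
    "(t *\<^sub>R A) ** C = t *\<^sub>R (A ** C)" "C ** (t *\<^sub>R A) = t *\<^sub>R (C ** A)"
  by (simp_all add: matrix_matrix_mult_def vec_eq_iff sum.distrib sum_distrib_left distrib_left
      distrib_right mult.left_commute mult.assoc)

lemma bilinear_commutator: "bilinear (commutator :: real^'n^'n \<Rightarrow> real^'n^'n \<Rightarrow> real^'n^'n)"
  unfolding bilinear_def commutator_def
  by (intro conjI allI linearI) (simp_all add: matrix_mult_linear scaleR_diff_right)

lemma commutator_swap: "commutator Y X = - commutator X Y"
  by (simp add: commutator_def)

lemma commutator_self [simp]: "commutator X X = 0"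
  by (simp add: commutator_def)

definition outer_product :: "real^'n \<Rightarrow> real^'n \<Rightarrow> real^'n^'n" where
  "outer_product v w = (\<chi> a b. v $ a * w $ b)"

lemma outer_product_mult: "outer_product v w *v z = (w \<bullet> z) *\<^sub>R v"
  by (simp add: outer_product_def matrix_vector_mult_def inner_vec_def vec_eq_iff
      sum_distrib_left mult.commute mult.left_commute)

lemma inner_outer_product: "X \<bullet> outer_product v w = v \<bullet> (X *v w)"
  by (simp add: outer_product_def matrix_vector_mult_def inner_vec_def
      sum_distrib_left mult.commute mult.left_commute)

lemma transpose_outer_product: "transpose (outer_product v w) = outer_product w v"
  by (simp add: outer_product_def transpose_def vec_eq_iff)

lemma orthonormal_parseval:
  fixes u :: "'n \<Rightarrow> real^'n"
  assumes u: "\<And>i j. u i \<bullet> u j = (if i = j then 1 else 0)"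
  shows "v \<bullet> w = (\<Sum>i\<in>UNIV. (u i \<bullet> v) * (u i \<bullet> w))"
proof -
  define U where "U = (\<chi> i. u i)"
  have "U ** transpose U = mat 1"
    using u by (simp add: U_def vec_eq_iff matrix_matrix_mult_def transpose_def mat_def inner_vec_def)
  then have *: "transpose U ** U = mat 1" by (simp add: matrix_left_right_inverse)
  have c: "(U *v z) $ i = u i \<bullet> z" for z i
    by (simp add: U_def matrix_vector_mul_component)
  have "v \<bullet> w = v \<bullet> ((transpose U ** U) *v w)" using * by simp
  also have "\<dots> = (U *v v) \<bullet> (U *v w)"
    by (metis dot_lmul_matrix inner_commute matrix_vector_mul_assoc transpose_matrix_vector)
  also have "\<dots> = (\<Sum>i\<in>UNIV. (u i \<bullet> v) * (u i \<bullet> w))"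
    by (simp add: inner_vec_def[of "U *v v"] c)
  finally show ?thesis .
qed

text \<open>The inner product of the type \<open>real^'n^'n\<close> is the Frobenius product, which can be computed from
  the entries with respect to any orthonormal basis.\<close>

lemma inner_matrix_orthonormal:
  fixes u :: "'n \<Rightarrow> real^'n"
  assumes u: "\<And>i j. u i \<bullet> u j = (if i = j then 1 else 0)"
  shows "X \<bullet> Y = (\<Sum>i\<in>UNIV. \<Sum>j\<in>UNIV. (u i \<bullet> (X *v u j)) * (u i \<bullet> (Y *v u j)))"
proof -
  have "X \<bullet> Y = (\<Sum>k\<in>UNIV. \<Sum>j\<in>UNIV. (u j \<bullet> X $ k) * (u j \<bullet> Y $ k))"
    unfolding inner_vec_def[of X] by (intro sum.cong refl orthonormal_parseval[OF u])
  also have "\<dots> = (\<Sum>j\<in>UNIV. (X *v u j) \<bullet> (Y *v u j))"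
    by (subst sum.swap) (simp add: inner_vec_def[of "_ *v _"] matrix_vector_mul_component inner_commute)
  also have "\<dots> = (\<Sum>j\<in>UNIV. \<Sum>i\<in>UNIV. (u i \<bullet> (X *v u j)) * (u i \<bullet> (Y *v u j)))"
    by (intro sum.cong refl orthonormal_parseval[OF u])
  finally show ?thesis by (subst sum.swap)
qed

section \<open>The commutator inequality for symmetric matrices\<close>

definition commutator_energy :: "real^'n^'n^'m \<Rightarrow> real" where
  "commutator_energy A = (\<Sum>r\<in>UNIV. \<Sum>s\<in>UNIV. (norm (commutator (A $ r) (A $ s)))\<^sup>2)"

definition symmetric_tuples :: "(real^'n^'n^'m) set" where
  "symmetric_tuples = {A. \<forall>r. transpose (A $ r) = A $ r}"

lemma transpose_linear:
  fixes X Y :: "real^'n^'n"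
  shows "transpose (X + Y) = transpose X + transpose Y" "transpose (t *\<^sub>R X) = t *\<^sub>R transpose X"
    "transpose 0 = (0 :: real^'n^'n)"
  by (simp_all add: transpose_def vec_eq_iff)

lemma subspace_symmetric: "subspace {X :: real^'n^'n. transpose X = X}"
  by (auto simp: subspace_def transpose_linear)

lemma subspace_symmetric_tuples: "subspace (symmetric_tuples :: (real^'n^'n^'m) set)"
  by (auto simp: subspace_def symmetric_tuples_def transpose_linear)

lemma commutator_scaleR: "commutator (t *\<^sub>R X) Y = t *\<^sub>R commutator X Y"
  "commutator X (t *\<^sub>R Y) = t *\<^sub>R commutator X Y"
  using bilinear_commutator bilinear_lmul bilinear_rmul by blast+

lemma commutator_add: "commutator (X + X') Y = commutator X Y + commutator X' Y"
  "commutator X (Y + Y') = commutator X Y + commutator X Y'"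
  using bilinear_commutator bilinear_ladd bilinear_radd by blast+

lemma commutator_sum: "commutator (sum f I) Y = (\<Sum>i\<in>I. commutator (f i) Y)"
  using linear_sum[of "\<lambda>X. commutator X Y" f I] bilinear_commutator by (auto simp: bilinear_def)

lemma commutator_energy_scaleR: "commutator_energy (t *\<^sub>R A) = t^4 * commutator_energy A"
  by (simp add: commutator_energy_def commutator_scaleR sum_distrib_left power_mult_distrib
      power2_eq_square power4_eq_xxxx mult_ac)

lemma continuous_commutator_energy: "continuous_on S commutator_energy"
proof -
  have b: "bounded_bilinear (commutator :: real^'n^'n \<Rightarrow> real^'n^'n \<Rightarrow> real^'n^'n)"
    using bilinear_commutator bilinear_conv_bounded_bilinear by blast
  show ?thesis unfolding commutator_energy_def[abs_def]
    by (intro continuous_intros bounded_bilinear.continuous_on[OF b])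
qed

lemma norm_tuple: "(norm (A :: real^'n^'n^'m))\<^sup>2 = (\<Sum>r\<in>UNIV. A $ r \<bullet> A $ r)"
  unfolding power2_norm_eq_inner by (simp add: inner_vec_def[of A])

text \<open>Vary the tuple to \<open>A\<^sub>r + t \<langle>A\<^sub>r, E\<rangle> E\<close>. Because \<open>[E, E] = 0\<close>, the commutators are affine in \<open>t\<close>, so
  both sides of the maximality condition are explicit polynomials in \<open>t\<close>. Their derivatives at 0
  agree, and by the eigenvector equation for \<open>E\<close> the derivative of the energy is \<open>4 b\<close> times the sum
  over \<open>r\<close> of \<open>|[E, A\<^sub>r]|\<^sup>2\<close>.\<close>

lemma energy_maximizer_stationary:
  fixes A :: "real^'n^'n^'m" and E :: "real^'n^'n"
  assumes A: "A \<in> symmetric_tuples" "norm A = 1"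
    and max: "\<And>X :: real^'n^'n^'m. X \<in> symmetric_tuples \<Longrightarrow> commutator_energy X \<le> commutator_energy A * ((norm X)\<^sup>2)\<^sup>2"
    and E: "transpose E = E" "norm E = 1"
    and eig: "(\<Sum>r\<in>UNIV. (A $ r \<bullet> E) *\<^sub>R A $ r) = b *\<^sub>R E" and b: "b \<noteq> 0"
  shows "(\<Sum>r\<in>UNIV. (norm (commutator E (A $ r)))\<^sup>2) = commutator_energy A"
proof -
  define M where "M = commutator_energy A"
  define a where "a r = A $ r \<bullet> E" for r
  define C where "C r s = commutator (A $ r) (A $ s)" for r s
  define D where "D r s = a r *\<^sub>R commutator E (A $ s) - a s *\<^sub>R commutator E (A $ r)" for r s
  define P where "P = (\<Sum>r\<in>UNIV. (norm (commutator E (A $ r)))\<^sup>2)"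
  define L where "L = (\<Sum>r\<in>UNIV. \<Sum>s\<in>UNIV. C r s \<bullet> D r s)"
  define Q where "Q = (\<Sum>r\<in>UNIV. \<Sum>s\<in>UNIV. D r s \<bullet> D r s)"
  have EE: "E \<bullet> E = 1" using E(2) by (simp add: dot_square_norm)
  have aa: "(\<Sum>r\<in>UNIV. (a r)\<^sup>2) = b"
  proof -
    have "(\<Sum>r\<in>UNIV. (a r)\<^sup>2) = (\<Sum>r\<in>UNIV. (A $ r \<bullet> E) *\<^sub>R A $ r) \<bullet> E"
      by (simp add: inner_sum_left a_def power2_eq_square)
    then show ?thesis using eig EE by simp
  qed
  let ?X = "\<lambda>t. (\<chi> r. A $ r + (t * a r) *\<^sub>R E)"
  have Xn: "(norm (?X t))\<^sup>2 = 1 + 2 * t * b + t\<^sup>2 * b" for t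
  proof -
    have "(norm (?X t))\<^sup>2 = (\<Sum>r\<in>UNIV. A $ r \<bullet> A $ r + (2 * t * (a r)\<^sup>2 + t\<^sup>2 * (a r)\<^sup>2))"
      unfolding norm_tuple
      by (intro sum.cong refl) (simp add: inner_add_left inner_add_right EE inner_commute[of E "A $ _"] a_def
          power2_eq_square algebra_simps)
    also have "\<dots> = (norm A)\<^sup>2 + 2 * t * b + t\<^sup>2 * b"
      by (simp add: sum.distrib norm_tuple sum_distrib_left[symmetric] aa)
    finally show ?thesis using A(2) by simp
  qed
  have Xe: "commutator_energy (?X t) = M + 2 * t * L + t\<^sup>2 * Q" for t
  proof -
    have "commutator (A $ r + (t * a r) *\<^sub>R E) (A $ s + (t * a s) *\<^sub>R E) = C r s + t *\<^sub>R D r s" for r s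
      by (simp add: commutator_add commutator_scaleR C_def D_def commutator_swap[of E "A $ r"]
          scaleR_diff_right scaleR_add_right)
    then have "commutator_energy (?X t)
        = (\<Sum>r\<in>UNIV. \<Sum>s\<in>UNIV. (norm (C r s))\<^sup>2 + (2 * t * (C r s \<bullet> D r s) + t\<^sup>2 * (D r s \<bullet> D r s)))"
      unfolding commutator_energy_def
      by (intro sum.cong refl) (simp add: power2_norm_eq_inner inner_add_left inner_add_right
          inner_commute[of "D _ _" "C _ _"] power2_eq_square[of t] distrib_left mult.assoc)
    also have "\<dots> = M + 2 * t * L + t\<^sup>2 * Q"
      by (simp add: sum.distrib M_def L_def Q_def commutator_energy_def C_def sum_distrib_left[symmetric])
    finally show ?thesis .
  qed
  have Xs: "?X t \<in> symmetric_tuples" for t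
    using A(1) E(1) by (simp add: symmetric_tuples_def transpose_linear)
  define f where "f t = M * (1 + 2 * t * b + t\<^sup>2 * b)\<^sup>2 - (M + 2 * t * L + t\<^sup>2 * Q)" for t
  have f0: "0 \<le> f t" for t
    using max[OF Xs[of t]] unfolding f_def Xn Xe M_def[symmetric] by simp
  have f00: "f 0 = 0" by (simp add: f_def)
  have "(f has_real_derivative 4 * M * b - 2 * L) (at 0)"
    unfolding f_def by (auto intro!: derivative_eq_intros)
  then have "4 * M * b - 2 * L = 0"
    by (rule DERIV_local_min[where d = 1]) (simp_all add: f0 f00)
  moreover have "L = 2 * b * P"
  proof -
    have "L = (\<Sum>r\<in>UNIV. \<Sum>s\<in>UNIV. a r * (C r s \<bullet> commutator E (A $ s)))
        - (\<Sum>r\<in>UNIV. \<Sum>s\<in>UNIV. a s * (C r s \<bullet> commutator E (A $ r)))"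
      by (simp add: L_def D_def inner_diff_right sum_subtractf)
    also have "(\<Sum>r\<in>UNIV. \<Sum>s\<in>UNIV. a s * (C r s \<bullet> commutator E (A $ r)))
        = - (\<Sum>r\<in>UNIV. \<Sum>s\<in>UNIV. a r * (C r s \<bullet> commutator E (A $ s)))"
    proof -
      have eq: "C r s = - C s r" for r s by (simp add: C_def commutator_swap[of "A $ r"])
      have "a s * (C r s \<bullet> commutator E (A $ r)) = - (a s * (C s r \<bullet> commutator E (A $ r)))" for r s
        unfolding eq[of r s] by simp
      then show ?thesis by (subst sum.swap) (simp add: sum_negf)
    qed
    also have "(\<Sum>r\<in>UNIV. \<Sum>s\<in>UNIV. a r * (C r s \<bullet> commutator E (A $ s)))
        = (\<Sum>s\<in>UNIV. commutator (\<Sum>r\<in>UNIV. a r *\<^sub>R A $ r) (A $ s) \<bullet> commutator E (A $ s))"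
      by (subst sum.swap) (simp add: commutator_sum commutator_scaleR inner_sum_left C_def)
    also have "\<dots> = b * P"
      using eig by (simp add: a_def commutator_scaleR P_def sum_distrib_left power2_norm_eq_inner)
    finally show ?thesis by simp
  qed
  ultimately have "b * (M - P) = 0" by (simp add: algebra_simps)
  then show ?thesis using b by (simp add: M_def P_def)
qed

text \<open>The heart of the matrix inequality. In an eigenbasis of \<open>E\<close> the left-hand side is
  \<open>\<Sum>\<^sub>i\<^sub>j (l\<^sub>i - l\<^sub>j)\<^sup>2 c\<^sub>i\<^sub>j\<close>, where \<open>c\<^sub>i\<^sub>j\<close> is the sum over \<open>r\<close> of the squared entries. Maximality of \<open>E\<close>
  enters through the bound \<open>c\<^sub>i\<^sub>j \<le> b / 2\<close> off the diagonal.\<close>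

lemma commutator_sum_bound:
  fixes A :: "'m::finite \<Rightarrow> real^'n^'n" and E :: "real^'n^'n"
  assumes A: "\<And>r. transpose (A r) = A r" and A1: "(\<Sum>r\<in>UNIV. A r \<bullet> A r) = 1"
    and E: "transpose E = E" "norm E = 1"
    and b: "(\<Sum>r\<in>UNIV. (A r \<bullet> E)\<^sup>2) = b"
    and top: "\<And>X. transpose X = X \<Longrightarrow> (\<Sum>r\<in>UNIV. (A r \<bullet> X)\<^sup>2) \<le> b * (X \<bullet> X)"
  shows "(\<Sum>r\<in>UNIV. (norm (commutator E (A r)))\<^sup>2) \<le> 1"
proof -
  obtain u :: "'n \<Rightarrow> real^'n" and l :: "'n \<Rightarrow> real"
    where u: "\<And>i j. u i \<bullet> u j = (if i = j then 1 else 0)" and l: "\<And>i. E *v u i = l i *\<^sub>R u i"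
    using symmetric_matrix_eigenbasis[OF E(1)] by blast
  define a where "a r i j = u i \<bullet> (A r *v u j)" for r i j
  define c where "c i j = (\<Sum>r\<in>UNIV. (a r i j)\<^sup>2)" for i j
  define w where "w i j = max 0 ((l i - l j)\<^sup>2 - 1)" for i j
  have adj: "(X *v x) \<bullet> y = x \<bullet> (X *v y)" if "transpose X = X" for X :: "real^'n^'n" and x y
    using that by (metis dot_lmul_matrix inner_commute transpose_matrix_vector)
  have asym: "a r i j = a r j i" for r i j
    unfolding a_def by (subst adj[OF A, symmetric]) (rule inner_commute)
  have b0: "b \<ge> 0" unfolding b[symmetric] by (intro sum_nonneg) simp
  have c0: "c i j \<ge> 0" for i j by (simp add: c_def sum_nonneg)
  have El: "u i \<bullet> (E *v u j) = (if i = j then l j else 0)" for i j by (simp add: l u)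
  have ll: "(\<Sum>i\<in>UNIV. (l i)\<^sup>2) = 1"
  proof -
    have "1 = E \<bullet> E" using E(2) by (simp add: dot_square_norm)
    also have "\<dots> = (\<Sum>i\<in>UNIV. \<Sum>j\<in>UNIV. if i = j then (l j)\<^sup>2 else 0)"
      unfolding inner_matrix_orthonormal[OF u] El
      by (intro sum.cong refl) (simp add: power2_eq_square)
    finally show ?thesis by simp
  qed
  have "(\<Sum>r\<in>UNIV. (norm (commutator E (A r)))\<^sup>2)
      = (\<Sum>r\<in>UNIV. \<Sum>i\<in>UNIV. \<Sum>j\<in>UNIV. (l i - l j)\<^sup>2 * (a r i j)\<^sup>2)"
  proof (intro sum.cong refl)
    fix r
    have "u i \<bullet> (commutator E (A r) *v u j) = (l i - l j) * a r i j" for i j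
    proof -
      have "u i \<bullet> ((E ** A r) *v u j) = l i * a r i j"
        unfolding matrix_vector_mul_assoc[symmetric] adj[OF E(1), symmetric] l by (simp add: a_def)
      moreover have "u i \<bullet> ((A r ** E) *v u j) = l j * a r i j"
        unfolding matrix_vector_mul_assoc[symmetric] l by (simp add: a_def matrix_vector_mult_scaleR)
      ultimately show ?thesis
        by (simp add: commutator_def matrix_vector_mult_diff_rdistrib inner_diff_right left_diff_distrib)
    qed
    then show "(norm (commutator E (A r)))\<^sup>2 = (\<Sum>i\<in>UNIV. \<Sum>j\<in>UNIV. (l i - l j)\<^sup>2 * (a r i j)\<^sup>2)"
      unfolding power2_norm_eq_inner inner_matrix_orthonormal[OF u]
      by (intro sum.cong refl) (simp add: power2_eq_square)
  qed
  also have "\<dots> = (\<Sum>i\<in>UNIV. \<Sum>j\<in>UNIV. (l i - l j)\<^sup>2 * c i j)"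
  proof -
    have "(\<Sum>r\<in>UNIV. \<Sum>i\<in>UNIV. \<Sum>j\<in>UNIV. (l i - l j)\<^sup>2 * (a r i j)\<^sup>2)
      = (\<Sum>i\<in>UNIV. \<Sum>r\<in>UNIV. \<Sum>j\<in>UNIV. (l i - l j)\<^sup>2 * (a r i j)\<^sup>2)" by (rule sum.swap)
    also have "\<dots> = (\<Sum>i\<in>UNIV. \<Sum>j\<in>UNIV. \<Sum>r\<in>UNIV. (l i - l j)\<^sup>2 * (a r i j)\<^sup>2)"
      by (intro sum.cong refl) (rule sum.swap)
    finally show ?thesis by (simp add: c_def sum_distrib_left)
  qed
  also have "\<dots> \<le> (\<Sum>i\<in>UNIV. \<Sum>j\<in>UNIV. (c i j - (if i = j then c i i else 0)) + w i j * (b / 2))"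
  proof (intro sum_mono)
    fix i j
    show "(l i - l j)\<^sup>2 * c i j \<le> (c i j - (if i = j then c i i else 0)) + w i j * (b / 2)"
    proof (cases "i = j")
      case False
      \<comment> \<open>This test matrix has squared norm 2, and its product with \<open>A r\<close> is twice the entry \<open>a r i j\<close>.\<close>
      let ?X = "outer_product (u i) (u j) + outer_product (u j) (u i)"
      have "transpose ?X = ?X" by (simp add: transpose_linear transpose_outer_product)
      from top[OF this] have "(\<Sum>r\<in>UNIV. (2 * a r i j)\<^sup>2) \<le> b * 2"
        using False
        by (simp add: inner_add_right inner_outer_product asym[of _ j i] a_def[symmetric]
            matrix_vector_mult_add_rdistrib outer_product_mult u)
      then have "c i j \<le> b / 2" by (simp add: c_def power_mult_distrib sum_distrib_left[symmetric])
      then have "w i j * c i j \<le> w i j * (b / 2)" by (intro mult_left_mono) (auto simp: w_def)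
      moreover have "((l i - l j)\<^sup>2 - 1) * c i j \<le> w i j * c i j"
        using c0 by (intro mult_right_mono) (auto simp: w_def)
      ultimately show ?thesis using False by (simp add: left_diff_distrib)
    qed (use b0 in \<open>simp add: w_def\<close>)
  qed
  also have "\<dots> = (\<Sum>i\<in>UNIV. \<Sum>j\<in>UNIV. c i j) - (\<Sum>i\<in>UNIV. c i i) + (\<Sum>i\<in>UNIV. \<Sum>j\<in>UNIV. w i j) * (b / 2)"
    by (simp add: sum.distrib sum_subtractf sum_distrib_right)
  also have "(\<Sum>i\<in>UNIV. \<Sum>j\<in>UNIV. c i j) = 1"
  proof -
    have "(\<Sum>i\<in>UNIV. \<Sum>j\<in>UNIV. c i j) = (\<Sum>i\<in>UNIV. \<Sum>r\<in>UNIV. \<Sum>j\<in>UNIV. (a r i j)\<^sup>2)"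
      unfolding c_def by (intro sum.cong refl) (rule sum.swap)
    also have "\<dots> = (\<Sum>r\<in>UNIV. \<Sum>i\<in>UNIV. \<Sum>j\<in>UNIV. (a r i j)\<^sup>2)" by (rule sum.swap)
    also have "\<dots> = (\<Sum>r\<in>UNIV. A r \<bullet> A r)"
      unfolding inner_matrix_orthonormal[OF u] by (simp add: a_def power2_eq_square)
    finally show ?thesis using A1 by simp
  qed
  also have "(\<Sum>i\<in>UNIV. \<Sum>j\<in>UNIV. w i j) * (b / 2) \<le> 2 * (b / 2)"
    using spread_excess[of l] ll b0 unfolding w_def by (intro mult_right_mono) auto
  \<comment> \<open>\<open>E\<close> is diagonal in this basis, so only diagonal entries of \<open>A r\<close> contribute to \<open>A r \<bullet> E\<close>.\<close>
  also have "b \<le> (\<Sum>i\<in>UNIV. c i i)"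
  proof -
    have "(A r \<bullet> E)\<^sup>2 \<le> (\<Sum>i\<in>UNIV. (a r i i)\<^sup>2)" for r
    proof -
      have "A r \<bullet> E = (\<Sum>i\<in>UNIV. a r i i * l i)"
        unfolding inner_matrix_orthonormal[OF u] El by (simp add: a_def if_distrib cong: if_cong)
      then have "(A r \<bullet> E)\<^sup>2 \<le> (\<Sum>i\<in>UNIV. (a r i i)\<^sup>2) * (\<Sum>i\<in>UNIV. (l i)\<^sup>2)"
        by (simp only: Cauchy_Schwarz_ineq_sum)
      then show ?thesis using ll by simp
    qed
    then have "b \<le> (\<Sum>r\<in>UNIV. \<Sum>i\<in>UNIV. (a r i i)\<^sup>2)" unfolding b[symmetric] by (intro sum_mono)
    then show ?thesis unfolding c_def by (subst sum.swap)
  qed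
  finally show ?thesis by simp
qed

text \<open>A maximizer on the unit sphere of symmetric tuples exists by compactness. The operator
  \<open>T X = \<Sum>\<^sub>r \<langle>B\<^sub>r, X\<rangle> B\<^sub>r\<close> is self-adjoint with quadratic form \<open>\<Sum>\<^sub>r \<langle>B\<^sub>r, X\<rangle>\<^sup>2\<close>, so its top eigenvector
  among the symmetric matrices is the matrix \<open>E\<close> of the two preceding lemmas.\<close>

theorem commutator_energy_le:
  fixes A :: "real^'n^'n^'m"
  assumes A: "\<And>r. transpose (A $ r) = A $ r"
  shows "commutator_energy A \<le> ((norm A)\<^sup>2)\<^sup>2"
proof (cases "A = 0")
  case True
  then show ?thesis
    using commutator_energy_scaleR[of 0 A] by simp
next
  case False
  let ?S = "symmetric_tuples :: (real^'n^'n^'m) set"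
  define K where "K = ?S \<inter> sphere 0 1"
  have AS: "A \<in> ?S" using A by (simp add: symmetric_tuples_def)
  have unit: "(1 / norm X) *\<^sub>R X \<in> K" if "X \<in> ?S" "X \<noteq> 0" for X
    using that subspace_scale[OF subspace_symmetric_tuples] by (auto simp: K_def)
  have "compact K"
    unfolding K_def using closed_subspace[OF subspace_symmetric_tuples] by (intro closed_Int_compact) auto
  moreover have "K \<noteq> {}" using unit[OF AS False] by auto
  ultimately obtain B where B: "B \<in> K" and Bmax: "\<And>X. X \<in> K \<Longrightarrow> commutator_energy X \<le> commutator_energy B"
    using continuous_attains_sup[OF _ _ continuous_commutator_energy, of K] by blast
  have BS: "B \<in> ?S" and B1: "norm B = 1" using B by (auto simp: K_def)
  have bound: "commutator_energy X \<le> commutator_energy B * ((norm X)\<^sup>2)\<^sup>2" if X: "X \<in> ?S" for X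
  proof (cases "X = 0")
    case True
    then show ?thesis using commutator_energy_scaleR[of 0 X] by simp
  next
    case False
    have "commutator_energy X = (norm X)^4 * commutator_energy ((1 / norm X) *\<^sub>R X)"
      using False commutator_energy_scaleR[of "norm X" "(1 / norm X) *\<^sub>R X"] by simp
    also have "\<dots> \<le> (norm X)^4 * commutator_energy B"
      by (intro mult_left_mono Bmax unit X False) simp
    finally show ?thesis by (simp add: power_mult[symmetric] mult.commute)
  qed
  define T where "T X = (\<Sum>r\<in>UNIV. (B $ r \<bullet> X) *\<^sub>R B $ r)" for X
  let ?V = "{X :: real^'n^'n. transpose X = X}"
  have Bsym: "transpose (B $ r) = B $ r" for r using BS by (simp add: symmetric_tuples_def)
  have XTX: "X \<bullet> T X = (\<Sum>r\<in>UNIV. (B $ r \<bullet> X)\<^sup>2)" for X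
    by (simp add: T_def inner_sum_right power2_eq_square inner_commute)
  have lin: "linear T"
    unfolding T_def
    by (intro linearI) (simp_all add: inner_add_right scaleR_add_left sum.distrib scaleR_sum_right)
  have sa: "T X \<bullet> Y = X \<bullet> T Y" for X Y
    by (simp add: T_def inner_sum_left inner_sum_right inner_commute mult.commute)
  have inv: "T ` ?V \<subseteq> ?V"
    unfolding T_def using Bsym
    by (auto intro!: subspace_sum[OF subspace_symmetric, simplified] simp: transpose_linear)
  have "mat 1 \<in> ?V" by simp
  moreover have "mat 1 \<noteq> (0 :: real^'n^'n)" by (auto simp: vec_eq_iff mat_def)
  ultimately have ne: "?V \<noteq> {0}" by blast
  obtain E b where EV: "E \<in> ?V" and E1: "norm E = 1" and TE: "T E = b *\<^sub>R E"
    and "\<And>X. X \<in> ?V \<Longrightarrow> X \<bullet> T X \<le> b * (X \<bullet> X)"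
    by (rule rayleigh_maximizer[OF lin sa subspace_symmetric inv ne], rule that)
  then have E: "transpose E = E" "norm E = 1"
    and top: "\<And>X. transpose X = X \<Longrightarrow> X \<bullet> T X \<le> b * (X \<bullet> X)" by auto
  have b: "(\<Sum>r\<in>UNIV. (B $ r \<bullet> E)\<^sup>2) = b"
    using XTX[of E] TE E(2) by (simp add: dot_square_norm)
  have "b \<noteq> 0"
  proof
    assume b0: "b = 0"
    have "B $ r = 0" for r
    proof -
      have "(B $ r \<bullet> B $ r)\<^sup>2 \<le> (\<Sum>s\<in>UNIV. (B $ s \<bullet> B $ r)\<^sup>2)"
        by (rule member_le_sum) auto
      also have "\<dots> \<le> 0" using top[OF Bsym[of r]] b0 by (simp add: XTX)
      finally show ?thesis by simp
    qed
    then have "B = 0" by (simp add: vec_eq_iff)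
    then show False using B1 by simp
  qed
  then have "commutator_energy B = (\<Sum>r\<in>UNIV. (norm (commutator E (B $ r)))\<^sup>2)"
    using energy_maximizer_stationary[OF BS B1 bound E TE[unfolded T_def]] by simp
  also have "\<dots> \<le> 1"
    using commutator_sum_bound[of "\<lambda>r. B $ r", OF Bsym _ E b] top B1 norm_tuple[of B]
    by (simp add: XTX)
  finally have "commutator_energy B \<le> 1" .
  then have "commutator_energy B * ((norm A)\<^sup>2)\<^sup>2 \<le> 1 * ((norm A)\<^sup>2)\<^sup>2"
    by (intro mult_right_mono) auto
  then show ?thesis using bound[OF AS] by simp
qed

section \<open>Smooth solutions of linear systems\<close>

text \<open>A finite type with as many elements as the dimension of \<open>'a\<close>. It makes matrices of that size
  available as \<open>real^'a basis_index^'a basis_index\<close>, although \<open>'a\<close> itself is infinite.\<close>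

typedef (overloaded) 'a basis_index = "Basis :: 'a::euclidean_space set"
  morphisms basis_vec basis_idx
  using nonempty_Basis by blast

lemma bij_basis_vec: "bij_betw basis_vec (UNIV :: 'a::euclidean_space basis_index set) (Basis :: 'a set)"
  using type_definition.Rep_range[OF type_definition_basis_index] basis_vec_inject
  by (auto simp: bij_betw_def inj_on_def)

instance basis_index :: (euclidean_space) finite
proof
  show "finite (UNIV :: 'a basis_index set)"
    using bij_betw_finite[OF bij_basis_vec] by simp
qed

lemma CARD_basis_index: "CARD('a::euclidean_space basis_index) = DIM('a)"
  using bij_betw_same_card[OF bij_basis_vec] .

lemma sum_basis_vec: "(\<Sum>i\<in>UNIV. f (basis_vec i)) = (\<Sum>b\<in>Basis. f b)"
  using sum.reindex_bij_betw[OF bij_basis_vec] .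

lemma differentiable_prod:
  fixes f :: "'i \<Rightarrow> 'a::real_normed_vector \<Rightarrow> real"
  assumes "\<And>i. i \<in> I \<Longrightarrow> f i differentiable (at x)"
  shows "(\<lambda>y. \<Prod>i\<in>I. f i y) differentiable (at x)"
  using assms by (induction I rule: infinite_finite_induct) (auto intro: differentiable_mult)

lemma differentiable_det:
  fixes A :: "'a::real_normed_vector \<Rightarrow> real^'n^'n"
  assumes "\<And>i j. (\<lambda>y. A y $ i $ j) differentiable (at x)"
  shows "(\<lambda>y. det (A y)) differentiable (at x)"
  unfolding det_def
  by (intro differentiable_sum ballI differentiable_mult differentiable_prod differentiable_const assms)
     (simp add: finite_permutations)

text \<open>The Christoffel symbols are defined implicitly, by their products with all vectors. Cramer's
  rule writes such a solution as a rational function of differentiable coefficients.\<close>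

lemma differentiable_solution:
  fixes B :: "'p::real_normed_vector \<Rightarrow> 'a::euclidean_space \<Rightarrow> 'a \<Rightarrow> real" and w :: "'p \<Rightarrow> 'a"
  assumes S: "open S" "x \<in> S"
    and bil: "\<And>y. y \<in> S \<Longrightarrow> bilinear (B y)"
    and pos: "\<And>y u. y \<in> S \<Longrightarrow> u \<noteq> 0 \<Longrightarrow> B y u u > 0"
    and dB: "\<And>a b. (\<lambda>y. B y a b) differentiable (at x)"
    and dk: "\<And>b. (\<lambda>y. k y b) differentiable (at x)"
    and sol: "\<And>y b. y \<in> S \<Longrightarrow> B y (w y) b = k y b"
  shows "w differentiable (at x)"
proof -
  define A :: "'p \<Rightarrow> real^'a basis_index^'a basis_index"
    where "A y = (\<chi> i j. B y (basis_vec j) (basis_vec i))" for y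
  define c :: "'p \<Rightarrow> real^'a basis_index" where "c y = (\<chi> i. w y \<bullet> basis_vec i)" for y
  define \<kappa> :: "'p \<Rightarrow> real^'a basis_index" where "\<kappa> y = (\<chi> i. k y (basis_vec i))" for y
  have expand: "v = (\<Sum>i\<in>UNIV. (v \<bullet> basis_vec i) *\<^sub>R basis_vec i)" for v :: 'a
    unfolding sum_basis_vec[of "\<lambda>b. (v \<bullet> b) *\<^sub>R b"] by (simp add: euclidean_representation)
  have app: "(A y *v z) $ i = B y (\<Sum>j\<in>UNIV. z $ j *\<^sub>R basis_vec j) (basis_vec i)" if "y \<in> S" for y z i
    by (simp add: A_def matrix_vector_mult_def bilinear_lmul[OF bil[OF that]] mult.commute
        linear_sum[of "\<lambda>a. B y a (basis_vec i)"] bil[OF that, unfolded bilinear_def])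
  have det: "det (A y) \<noteq> 0" if y: "y \<in> S" for y
  proof -
    have "z = 0" if z: "A y *v z = 0" for z
    proof -
      let ?v = "\<Sum>j\<in>UNIV. z $ j *\<^sub>R (basis_vec j :: 'a)"
      have 0: "B y ?v b = 0" if "b \<in> Basis" for b
        using app[OF y, of z "basis_idx b"] z that by (simp add: basis_idx_inverse)
      have l: "linear (B y ?v)" using bil[OF y] by (simp add: bilinear_def)
      have "B y ?v v = 0" for v
        using linear_eq_0_on_span[OF l 0] by simp
      then have "?v = 0" using pos[OF y] by (metis less_irrefl)
      then have "?v \<bullet> basis_vec i = 0" for i by simp
      moreover have "?v \<bullet> basis_vec i = z $ i" for i
      proof -
        have orth: "basis_vec j \<bullet> basis_vec i = (if j = i then 1 else (0::real))" for j i :: "'a basis_index"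
          using basis_vec[of i] basis_vec[of j] by (simp add: inner_Basis basis_vec_inject)
        show ?thesis by (simp add: inner_sum_left orth if_distrib cong: if_cong)
      qed
      ultimately show "z = 0" by (simp add: vec_eq_iff)
    qed
    then have "invertible (A y)"
      using matrix_left_invertible_ker[of "A y"] invertible_left_inverse[of "A y"] by blast
    then show ?thesis by (simp add: invertible_det_nz)
  qed
  let ?N = "\<lambda>y j. det (\<chi> i l. if l = j then \<kappa> y $ i else A y $ i $ l)"
  have w: "w y = (\<Sum>j\<in>UNIV. (?N y j / det (A y)) *\<^sub>R basis_vec j)" if y: "y \<in> S" for y
  proof -
    have "A y *v c y = \<kappa> y"
    proof -
      have "(A y *v c y) $ i = \<kappa> y $ i" for i
        unfolding app[OF y] c_def \<kappa>_def using expand[of "w y"] sol[OF y] by simp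
      then show ?thesis by (simp add: vec_eq_iff)
    qed
    then have "c y = (\<chi> j. ?N y j / det (A y))" using cramer[OF det[OF y]] by blast
    then have "w y \<bullet> basis_vec j = ?N y j / det (A y)" for j
      by (simp add: c_def vec_eq_iff)
    then show ?thesis using expand[of "w y"] by simp
  qed
  have dA: "(\<lambda>y. A y $ i $ j) differentiable (at x)" for i j by (simp add: A_def dB)
  have "(\<lambda>y. if l = j then \<kappa> y $ i else A y $ i $ l) differentiable (at x)" for i j l
    by (cases "l = j") (simp_all add: \<kappa>_def dk dA)
  then have "(\<lambda>y. ?N y j) differentiable (at x)" for j by (intro differentiable_det) simp
  moreover have "(\<lambda>y. det (A y)) differentiable (at x)" by (rule differentiable_det[OF dA])
  ultimately have "(\<lambda>y. \<Sum>j\<in>UNIV. (?N y j / det (A y)) *\<^sub>R basis_vec j :: 'a) differentiable (at x)"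
    using det[OF S(2)]
    by (intro differentiable_sum ballI differentiable_scaleR differentiable_divide differentiable_const) auto
  then obtain D where
    "((\<lambda>y. \<Sum>j\<in>UNIV. (?N y j / det (A y)) *\<^sub>R basis_vec j :: 'a) has_derivative D) (at x)"
    unfolding differentiable_def by blast
  from has_derivative_transform_within_open[OF this S, of w] w show ?thesis
    unfolding differentiable_def by auto
qed

section \<open>Calculus of smooth maps\<close>

lemma has_derivative_deriv_at:
  "f differentiable (at x) \<Longrightarrow> (f has_derivative deriv_at f x) (at x)"
  by (simp add: frechet_derivative_works)

lemma deriv_at_eqI: "(f has_derivative f') (at x) \<Longrightarrow> deriv_at f x v = f' v"
  using frechet_derivative_at by metis

lemma deriv_at_cong:
  assumes "f differentiable (at x)" "open S" "x \<in> S" "\<And>y. y \<in> S \<Longrightarrow> f y = g y"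
  shows "deriv_at g x v = deriv_at f x v"
  using frechet_derivative_transform_within_open[OF assms] by simp

lemma differentiable_cong:
  assumes "f differentiable (at x)" "open S" "x \<in> S" "\<And>y. y \<in> S \<Longrightarrow> f y = g y"
  shows "g differentiable (at x)"
  using has_derivative_transform_within_open[OF has_derivative_deriv_at[OF assms(1)] assms(2-4)]
  unfolding differentiable_def by blast

lemma Ck_on_subset: "Ck_on k S f \<Longrightarrow> T \<subseteq> S \<Longrightarrow> Ck_on k T f"
  by (induction k arbitrary: f) (auto intro: continuous_on_subset)

lemma Ck_on_cong:
  assumes "open S" "\<And>x. x \<in> S \<Longrightarrow> f x = g x"
  shows "Ck_on k S f \<Longrightarrow> Ck_on k S g"
  using assms(2)
proof (induction k arbitrary: f g)
  case 0
  then show ?case using continuous_on_cong by (metis Ck_on.simps(1))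
next
  case (Suc k)
  have d: "g differentiable (at x)" "frechet_derivative f (at x) = frechet_derivative g (at x)"
    if x: "x \<in> S" for x
  proof -
    have f: "f differentiable (at x)" using Suc.prems(1) x by simp
    then show "frechet_derivative f (at x) = frechet_derivative g (at x)"
      by (rule frechet_derivative_transform_within_open[OF _ assms(1) x Suc.prems(2)])
    show "g differentiable (at x)"
      by (rule differentiable_cong[OF f assms(1) x Suc.prems(2)])
  qed
  have "Ck_on k S (\<lambda>x. deriv_at g x v)" for v
    by (rule Suc.IH[of "\<lambda>x. deriv_at f x v"]) (use Suc.prems d in auto)
  then show ?case using d by simp
qed

lemma Ck_on_Suc_lower: "Ck_on (Suc k) S f \<Longrightarrow> Ck_on k S f"
proof (induction k arbitrary: f)
  case 0
  then show ?case
    by (auto simp: continuous_on_eq_continuous_within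
        intro!: differentiable_imp_continuous_within intro: differentiable_at_withinI)
next
  case (Suc k)
  then show ?case by (metis Ck_on.simps(2))
qed

lemma Ck_on_add:
  assumes "open S"
  shows "Ck_on k S f \<Longrightarrow> Ck_on k S g \<Longrightarrow> Ck_on k S (\<lambda>x. f x + g x)"
proof (induction k arbitrary: f g)
  case (Suc k)
  have D: "((\<lambda>x. f x + g x) has_derivative (\<lambda>v. deriv_at f x v + deriv_at g x v)) (at x)"
    if "x \<in> S" for x
    by (intro has_derivative_add has_derivative_deriv_at) (use Suc.prems that in auto)
  then have eq: "deriv_at f x v + deriv_at g x v = deriv_at (\<lambda>x. f x + g x) x v" if "x \<in> S" for x v
    using deriv_at_eqI[OF D] that by simp
  have "Ck_on k S (\<lambda>x. deriv_at (\<lambda>x. f x + g x) x v)" for v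
    by (rule Ck_on_cong[OF assms eq Suc.IH]) (use Suc.prems in auto)
  then show ?case using D unfolding Ck_on.simps differentiable_def by blast
qed (auto intro: continuous_intros)

lemma Ck_on_scaleR:
  fixes f :: "_ \<Rightarrow> real"
  assumes "open S"
  shows "Ck_on k S f \<Longrightarrow> Ck_on k S g \<Longrightarrow> Ck_on k S (\<lambda>x. f x *\<^sub>R g x)"
proof (induction k arbitrary: f g)
  case (Suc k)
  have D: "((\<lambda>x. f x *\<^sub>R g x) has_derivative (\<lambda>v. f x *\<^sub>R deriv_at g x v + deriv_at f x v *\<^sub>R g x)) (at x)"
    if "x \<in> S" for x
    by (intro has_derivative_scaleR has_derivative_deriv_at) (use Suc.prems that in auto)
  then have eq: "f x *\<^sub>R deriv_at g x v + deriv_at f x v *\<^sub>R g x = deriv_at (\<lambda>x. f x *\<^sub>R g x) x v"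
    if "x \<in> S" for x v
    using deriv_at_eqI[OF D] that by simp
  have "Ck_on k S (\<lambda>x. deriv_at (\<lambda>x. f x *\<^sub>R g x) x v)" for v
    by (rule Ck_on_cong[OF assms eq Ck_on_add[OF assms Suc.IH Suc.IH]])
       (use Suc.prems Ck_on_Suc_lower in auto)
  then show ?case using D unfolding Ck_on.simps differentiable_def by blast
qed (auto intro: continuous_intros)

lemma Ck_on_const: "Ck_on k S (\<lambda>x. c)"
  by (induction k arbitrary: c) auto

lemma Ck_on_inner_const:
  fixes f :: "_ \<Rightarrow> 'b::real_inner"
  assumes "open S"
  shows "Ck_on k S f \<Longrightarrow> Ck_on k S (\<lambda>x. f x \<bullet> b)"
proof (induction k arbitrary: f)
  case (Suc k)
  have D: "((\<lambda>x. f x \<bullet> b) has_derivative (\<lambda>v. deriv_at f x v \<bullet> b)) (at x)"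
    if "x \<in> S" for x
    by (intro has_derivative_inner_left has_derivative_deriv_at) (use Suc.prems that in auto)
  then have eq: "deriv_at f x v \<bullet> b = deriv_at (\<lambda>x. f x \<bullet> b) x v"
    if "x \<in> S" for x v
    using deriv_at_eqI[OF D] that by simp
  have "Ck_on k S (\<lambda>x. deriv_at (\<lambda>x. f x \<bullet> b) x v)" for v
    by (rule Ck_on_cong[OF assms eq Suc.IH]) (use Suc.prems in auto)
  then show ?case using D unfolding Ck_on.simps differentiable_def by blast
qed (auto intro: continuous_intros)

lemma smooth_on_subset: "smooth_on S f \<Longrightarrow> T \<subseteq> S \<Longrightarrow> smooth_on T f"
  by (auto simp: smooth_on_def intro: Ck_on_subset)

lemma smooth_on_imp_differentiable: "smooth_on S f \<Longrightarrow> x \<in> S \<Longrightarrow> f differentiable (at x)"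
  unfolding smooth_on_def using Ck_on.simps(2) by blast

lemma smooth_on_imp_continuous: "smooth_on S f \<Longrightarrow> continuous_on S f"
  unfolding smooth_on_def using Ck_on.simps(1) by blast

lemma smooth_on_deriv: "smooth_on S f \<Longrightarrow> smooth_on S (\<lambda>x. deriv_at f x v)"
  unfolding smooth_on_def using Ck_on.simps(2) by blast

lemma smooth_on_sum:
  assumes "open S" "finite I" "\<And>i. i \<in> I \<Longrightarrow> smooth_on S (f i)"
  shows "smooth_on S (\<lambda>x. \<Sum>i\<in>I. f i x)"
  using assms(2,3)
  by (induction I rule: finite_induct) (simp_all add: smooth_on_def Ck_on_const Ck_on_add assms(1))

lemma smooth_on_deriv_field:
  fixes F :: "'a::euclidean_space \<Rightarrow> 'b::real_normed_vector"
  assumes S: "open S" and F: "smooth_on S F" and Y: "smooth_on S Y"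
  shows "smooth_on S (\<lambda>x. deriv_at F x (Y x))"
proof -
  have "smooth_on S (\<lambda>x. (Y x \<bullet> b) *\<^sub>R deriv_at F x b)" for b
    using smooth_on_deriv[OF F, of b] Y unfolding smooth_on_def
    by (intro allI Ck_on_scaleR Ck_on_inner_const S) auto
  then have sm: "smooth_on S (\<lambda>x. \<Sum>b\<in>Basis. (Y x \<bullet> b) *\<^sub>R deriv_at F x b)"
    by (intro smooth_on_sum S) auto
  have eq: "(\<Sum>b\<in>Basis. (Y x \<bullet> b) *\<^sub>R deriv_at F x b) = deriv_at F x (Y x)" if "x \<in> S" for x
  proof -
    have l: "linear (deriv_at F x)"
      using smooth_on_imp_differentiable[OF F that] by (rule linear_frechet_derivative)
    have "deriv_at F x (\<Sum>b\<in>Basis. (Y x \<bullet> b) *\<^sub>R b) = (\<Sum>b\<in>Basis. (Y x \<bullet> b) *\<^sub>R deriv_at F x b)"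
      by (simp add: linear_sum[OF l] linear_scale[OF l])
    then show ?thesis by (simp add: euclidean_representation)
  qed
  show ?thesis
    using sm unfolding smooth_on_def by (intro allI Ck_on_cong[OF S eq]) auto
qed

text \<open>Two applications of the mean value theorem to the second difference of \<open>f\<close> over a parallelogram,
  the first in the direction \<open>u\<close> and the second in the direction \<open>v\<close>. The second difference is symmetric
  in \<open>u\<close> and \<open>v\<close>, which yields the symmetry of second derivatives.\<close>

lemma second_difference_mean_value:
  fixes f :: "'a::real_normed_vector \<Rightarrow> real"
  assumes ball: "ball x r \<subseteq> S" and t: "t > 0" "t * (norm u + norm v) < r"
    and d1: "\<And>y. y \<in> S \<Longrightarrow> f differentiable (at y)"
    and d2: "\<And>y. y \<in> S \<Longrightarrow> (\<lambda>z. deriv_at f z u) differentiable (at y)"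
  obtains y where "dist x y \<le> t * (norm u + norm v)"
    "f (x + t *\<^sub>R u + t *\<^sub>R v) - f (x + t *\<^sub>R u) - f (x + t *\<^sub>R v) + f x
      = t\<^sup>2 * deriv_at (\<lambda>z. deriv_at f z u) y v"
proof -
  have inS: "dist x (x + a *\<^sub>R u + b *\<^sub>R v) \<le> t * (norm u + norm v)" "x + a *\<^sub>R u + b *\<^sub>R v \<in> S"
    if "0 \<le> a" "a \<le> t" "0 \<le> b" "b \<le> t" for a b
  proof -
    have "dist x (x + a *\<^sub>R u + b *\<^sub>R v) = norm (a *\<^sub>R u + b *\<^sub>R v)"
    proof -
      have "x - (x + a *\<^sub>R u + b *\<^sub>R v) = - (a *\<^sub>R u + b *\<^sub>R v)" by simp
      then show ?thesis by (simp only: dist_norm norm_minus_cancel)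
    qed
    also have "\<dots> \<le> a * norm u + b * norm v" using norm_triangle_ineq[of "a *\<^sub>R u" "b *\<^sub>R v"] that by simp
    also have "\<dots> \<le> t * (norm u + norm v)"
      unfolding distrib_left by (intro add_mono mult_right_mono that) auto
    finally show 1: "dist x (x + a *\<^sub>R u + b *\<^sub>R v) \<le> t * (norm u + norm v)" .
    then show "x + a *\<^sub>R u + b *\<^sub>R v \<in> S" using ball t(2) by (auto simp: subset_iff)
  qed
  let ?\<phi> = "\<lambda>s. f (x + s *\<^sub>R u + t *\<^sub>R v) - f (x + s *\<^sub>R u + 0 *\<^sub>R v)"
  have line: "((\<lambda>s. f (x + s *\<^sub>R u + c *\<^sub>R v)) has_real_derivative deriv_at f (x + s *\<^sub>R u + c *\<^sub>R v) u) (at s)"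
    if "0 \<le> s" "s \<le> t" "0 \<le> c" "c \<le> t" for s c
  proof -
    have "((\<lambda>s. f (x + s *\<^sub>R u + c *\<^sub>R v)) has_derivative (\<lambda>h. deriv_at f (x + s *\<^sub>R u + c *\<^sub>R v) (h *\<^sub>R u))) (at s)"
      by (rule has_derivative_compose[of "\<lambda>s. x + s *\<^sub>R u + c *\<^sub>R v" _ _ _ f])
        (auto intro!: derivative_eq_intros has_derivative_deriv_at d1 inS that)
    then show ?thesis
      by (rule has_derivative_imp_has_field_derivative)
         (simp add: linear_scale[OF linear_frechet_derivative[OF d1[OF inS(2)[OF that]]]])
  qed
  have "\<exists>s. 0 < s \<and> s < t \<and> ?\<phi> t - ?\<phi> 0
      = (t - 0) * (deriv_at f (x + s *\<^sub>R u + t *\<^sub>R v) u - deriv_at f (x + s *\<^sub>R u + 0 *\<^sub>R v) u)"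
    by (rule MVT2[OF t(1)]) (intro DERIV_diff line; use t in simp)
  then obtain s where s: "0 < s" "s < t" "?\<phi> t - ?\<phi> 0
      = t * (deriv_at f (x + s *\<^sub>R u + t *\<^sub>R v) u - deriv_at f (x + s *\<^sub>R u + 0 *\<^sub>R v) u)" by auto
  let ?D = "\<lambda>z. deriv_at f z u"
  have line2: "((\<lambda>c. ?D (x + s *\<^sub>R u + c *\<^sub>R v)) has_real_derivative deriv_at ?D (x + s *\<^sub>R u + c *\<^sub>R v) v) (at c)"
    if "0 \<le> c" "c \<le> t" for c
  proof -
    have in': "x + s *\<^sub>R u + c *\<^sub>R v \<in> S" using inS that s by simp
    have "((\<lambda>c. ?D (x + s *\<^sub>R u + c *\<^sub>R v)) has_derivative (\<lambda>h. deriv_at ?D (x + s *\<^sub>R u + c *\<^sub>R v) (h *\<^sub>R v))) (at c)"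
      by (rule has_derivative_compose[of "\<lambda>c. x + s *\<^sub>R u + c *\<^sub>R v" _ _ _ ?D])
        (auto intro!: derivative_eq_intros has_derivative_deriv_at d2 in')
    then show ?thesis
      by (rule has_derivative_imp_has_field_derivative)
         (simp add: linear_scale[OF linear_frechet_derivative[OF d2[OF in']]])
  qed
  have "\<exists>c. 0 < c \<and> c < t \<and> ?D (x + s *\<^sub>R u + t *\<^sub>R v) - ?D (x + s *\<^sub>R u + 0 *\<^sub>R v)
      = (t - 0) * deriv_at ?D (x + s *\<^sub>R u + c *\<^sub>R v) v"
    by (rule MVT2[OF t(1)]) (intro line2; simp)
  then obtain c where c: "0 < c" "c < t" "?D (x + s *\<^sub>R u + t *\<^sub>R v) - ?D (x + s *\<^sub>R u + 0 *\<^sub>R v)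
      = t * deriv_at ?D (x + s *\<^sub>R u + c *\<^sub>R v) v" by auto
  show ?thesis
  proof (rule that[of "x + s *\<^sub>R u + c *\<^sub>R v"])
    show "dist x (x + s *\<^sub>R u + c *\<^sub>R v) \<le> t * (norm u + norm v)" using inS s c by simp
    show "f (x + t *\<^sub>R u + t *\<^sub>R v) - f (x + t *\<^sub>R u) - f (x + t *\<^sub>R v) + f x
      = t\<^sup>2 * deriv_at (\<lambda>z. deriv_at f z u) (x + s *\<^sub>R u + c *\<^sub>R v) v"
      using s(3) c(3) by (simp add: power2_eq_square)
  qed
qed

lemma second_derivative_symmetric_real:
  fixes f :: "'a::real_normed_vector \<Rightarrow> real"
  assumes S: "open S" "x \<in> S" and f: "smooth_on S f"
  shows "deriv_at (\<lambda>y. deriv_at f y u) x v = deriv_at (\<lambda>y. deriv_at f y v) x u"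
proof -
  let ?P = "\<lambda>y. deriv_at (\<lambda>z. deriv_at f z u) y v" and ?Q = "\<lambda>y. deriv_at (\<lambda>z. deriv_at f z v) y u"
  obtain r where r: "r > 0" "ball x r \<subseteq> S" using openE[OF S] by blast
  have cont: "isCont ?P x" "isCont ?Q x"
    using smooth_on_imp_continuous[OF smooth_on_deriv[OF smooth_on_deriv[OF f]]] S
    by (simp_all add: continuous_on_eq_continuous_at)
  have d1: "\<And>y. y \<in> S \<Longrightarrow> f differentiable (at y)"
    and d2: "\<And>w y. y \<in> S \<Longrightarrow> (\<lambda>z. deriv_at f z w) differentiable (at y)"
    using smooth_on_imp_differentiable f smooth_on_deriv by blast+
  define K where "K = norm u + norm v"
  \<comment> \<open>Parallelograms shrinking to \<open>x\<close> inside the ball; the summand 1 covers the case \<open>u = v = 0\<close>.\<close>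
  define t where "t k = r / (2 * (K + 1)) / real (Suc k)" for k
  have K: "K \<ge> 0" by (simp add: K_def)
  have t0: "t k > 0" for k using r K by (simp add: t_def)
  have tK: "t k * K < r" for k
  proof -
    have "t k * K \<le> r / (2 * (K + 1)) * K"
      using r K by (intro mult_right_mono) (auto simp: t_def divide_le_eq)
    also have "\<dots> = r * (K / (2 * (K + 1)))" by simp
    also have "\<dots> < r * 1" using r K by (intro mult_strict_left_mono) (auto simp: divide_less_eq)
    finally have "t k * K < r * 1" .
    then show ?thesis by simp
  qed
  have tl: "(\<lambda>k. t k * K) \<longlonglongrightarrow> 0"
    unfolding t_def by (intro tendsto_mult_left_zero lim_const_over_n[THEN LIMSEQ_Suc])
  have "\<forall>k. \<exists>p. dist x (fst p) \<le> t k * K \<and> dist x (snd p) \<le> t k * K \<and> ?P (fst p) = ?Q (snd p)"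
  proof
    fix k
    obtain y where y: "dist x y \<le> t k * (norm u + norm v)"
      "f (x + t k *\<^sub>R u + t k *\<^sub>R v) - f (x + t k *\<^sub>R u) - f (x + t k *\<^sub>R v) + f x = (t k)\<^sup>2 * ?P y"
      by (rule second_difference_mean_value[OF r(2) t0[of k] tK[of k, unfolded K_def] d1 d2[of _ u]]) blast
    obtain z where z: "dist x z \<le> t k * (norm v + norm u)"
      "f (x + t k *\<^sub>R v + t k *\<^sub>R u) - f (x + t k *\<^sub>R v) - f (x + t k *\<^sub>R u) + f x = (t k)\<^sup>2 * ?Q z"
      by (rule second_difference_mean_value[OF r(2) t0[of k]
            tK[of k, unfolded K_def add.commute[of "norm u"]] d1 d2[of _ v]]) blast
    have "x + t k *\<^sub>R v + t k *\<^sub>R u = x + t k *\<^sub>R u + t k *\<^sub>R v" by simp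
    with y(2) z(2) have "(t k)\<^sup>2 * ?P y = (t k)\<^sup>2 * ?Q z" by (simp only:)
    then have "?P y = ?Q z" using t0[of k] by simp
    then show "\<exists>p. dist x (fst p) \<le> t k * K \<and> dist x (snd p) \<le> t k * K \<and> ?P (fst p) = ?Q (snd p)"
      using y(1) z(1) by (intro exI[of _ "(y, z)"]) (simp add: K_def add.commute[of "norm v"])
  qed
  from choice[OF this] obtain p where p: "\<forall>k. dist x (fst (p k)) \<le> t k * K
      \<and> dist x (snd (p k)) \<le> t k * K \<and> ?P (fst (p k)) = ?Q (snd (p k))" ..
  define y z where "y k = fst (p k)" and "z k = snd (p k)" for k
  have yz: "\<And>k. dist x (y k) \<le> t k * K" "\<And>k. dist x (z k) \<le> t k * K" "\<And>k. ?P (y k) = ?Q (z k)"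
    using p by (simp_all add: y_def z_def)
  have conv: "w \<longlonglongrightarrow> x" if "\<And>k. dist x (w k) \<le> t k * K" for w :: "nat \<Rightarrow> 'a"
  proof -
    have "(\<lambda>k. dist (w k) x) \<longlonglongrightarrow> 0"
      by (rule tendsto_sandwich[OF _ _ tendsto_const tl]) (simp_all add: that dist_commute[of _ x])
    then show ?thesis by (rule iffD2[OF tendsto_dist_iff])
  qed
  have "(\<lambda>k. ?P (y k)) \<longlonglongrightarrow> ?P x"
    using isCont_tendsto_compose[where g = "?P" and f = y, OF cont(1) conv[OF yz(1)]] .
  moreover have "(\<lambda>k. ?Q (z k)) \<longlonglongrightarrow> ?Q x"
    using isCont_tendsto_compose[where g = "?Q" and f = z, OF cont(2) conv[OF yz(2)]] .
  ultimately show ?thesis unfolding yz(3) by (rule LIMSEQ_unique)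
qed

lemma deriv_at_inner:
  assumes "f differentiable (at x)"
  shows "deriv_at (\<lambda>y. f y \<bullet> b) x v = deriv_at f x v \<bullet> b"
  by (rule deriv_at_eqI[OF has_derivative_inner_left[OF has_derivative_deriv_at[OF assms]]])

lemma second_derivative_symmetric:
  fixes f :: "'a::real_normed_vector \<Rightarrow> 'b::euclidean_space"
  assumes S: "open S" "x \<in> S" and f: "smooth_on S f"
  shows "deriv_at (\<lambda>y. deriv_at f y u) x v = deriv_at (\<lambda>y. deriv_at f y v) x u"
proof (rule euclidean_eqI)
  fix b :: 'b
  have g: "smooth_on S (\<lambda>y. f y \<bullet> b)"
    using f S(1) by (simp add: smooth_on_def Ck_on_inner_const)
  have *: "deriv_at (\<lambda>y. deriv_at (\<lambda>y. f y \<bullet> b) y u) x v = deriv_at (\<lambda>y. deriv_at f y u) x v \<bullet> b" for u v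
  proof -
    have d: "(\<lambda>y. deriv_at f y u) differentiable (at x)"
      using smooth_on_imp_differentiable[OF smooth_on_deriv[OF f] S(2)] .
    have "deriv_at (\<lambda>y. deriv_at (\<lambda>y. f y \<bullet> b) y u) x v = deriv_at (\<lambda>y. deriv_at f y u \<bullet> b) x v"
      by (rule deriv_at_cong[OF _ S])
         (use d smooth_on_imp_differentiable[OF f] in \<open>auto simp: deriv_at_inner\<close>)
    then show ?thesis using deriv_at_inner[OF d] by simp
  qed
  show "deriv_at (\<lambda>y. deriv_at f y u) x v \<bullet> b = deriv_at (\<lambda>y. deriv_at f y v) x u \<bullet> b"
    using second_derivative_symmetric_real[OF S g, of u v] by (simp only: *)
qed

text \<open>The product rule for a family of linear maps applied to a vector field. The first term is the
  derivative of the family on the frozen vector \<open>V x\<close>, which keeps the coordinate formulas for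
  connections and metrics free of components.\<close>

lemma has_derivative_linear_family:
  fixes L :: "'p::real_normed_vector \<Rightarrow> 'a::euclidean_space \<Rightarrow> 'b::real_normed_vector"
  assumes S: "open S" "x \<in> S" and lin: "\<And>y. y \<in> S \<Longrightarrow> linear (L y)"
    and dL: "\<And>a. (\<lambda>y. L y a) differentiable (at x)"
    and V: "(V has_derivative V') (at x)"
  shows "((\<lambda>y. L y (V y)) has_derivative (\<lambda>d. deriv_at (\<lambda>y. L y (V x)) x d + L x (V' d))) (at x)"
proof -
  have ex: "L y v = (\<Sum>b\<in>Basis. (v \<bullet> b) *\<^sub>R L y b)" if "y \<in> S" for y v
  proof -
    have "L y (\<Sum>b\<in>Basis. (v \<bullet> b) *\<^sub>R b) = (\<Sum>b\<in>Basis. (v \<bullet> b) *\<^sub>R L y b)"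
      by (simp add: linear_sum[OF lin[OF that]] linear_scale[OF lin[OF that]])
    then show ?thesis by (simp add: euclidean_representation)
  qed
  have "((\<lambda>y. \<Sum>b\<in>Basis. (V y \<bullet> b) *\<^sub>R L y b) has_derivative
      (\<lambda>d. \<Sum>b\<in>Basis. (V x \<bullet> b) *\<^sub>R deriv_at (\<lambda>y. L y b) x d + (V' d \<bullet> b) *\<^sub>R L x b)) (at x)"
    by (intro has_derivative_sum has_derivative_scaleR has_derivative_inner_left V has_derivative_deriv_at dL)
  moreover have "deriv_at (\<lambda>y. L y (V x)) x d = (\<Sum>b\<in>Basis. (V x \<bullet> b) *\<^sub>R deriv_at (\<lambda>y. L y b) x d)" for d
  proof (rule deriv_at_eqI)
    have "((\<lambda>y. \<Sum>b\<in>Basis. (V x \<bullet> b) *\<^sub>R L y b) has_derivative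
      (\<lambda>d. \<Sum>b\<in>Basis. (V x \<bullet> b) *\<^sub>R deriv_at (\<lambda>y. L y b) x d)) (at x)"
      by (intro has_derivative_sum has_derivative_scaleR_right has_derivative_deriv_at dL)
    then show "((\<lambda>y. L y (V x)) has_derivative
      (\<lambda>d. \<Sum>b\<in>Basis. (V x \<bullet> b) *\<^sub>R deriv_at (\<lambda>y. L y b) x d)) (at x)"
      by (rule has_derivative_transform_within_open[OF _ S]) (simp add: ex[symmetric])
  qed
  ultimately have "((\<lambda>y. \<Sum>b\<in>Basis. (V y \<bullet> b) *\<^sub>R L y b) has_derivative
      (\<lambda>d. deriv_at (\<lambda>y. L y (V x)) x d + L x (V' d))) (at x)"
    by (simp add: sum.distrib ex[OF S(2), symmetric])
  then show ?thesis
    by (rule has_derivative_transform_within_open[OF _ S]) (simp add: ex[symmetric])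
qed

lemma linear_deriv_linear_family:
  fixes L :: "'p::real_normed_vector \<Rightarrow> 'a::real_vector \<Rightarrow> 'b::real_normed_vector"
  assumes S: "open S" "x \<in> S" and lin: "\<And>y. y \<in> S \<Longrightarrow> linear (L y)"
    and dL: "\<And>a. (\<lambda>y. L y a) differentiable (at x)"
  shows "linear (\<lambda>a. deriv_at (\<lambda>y. L y a) x d)"
proof (rule linearI)
  fix a b and c :: real
  have "((\<lambda>y. L y a + L y b) has_derivative (\<lambda>d. deriv_at (\<lambda>y. L y a) x d + deriv_at (\<lambda>y. L y b) x d)) (at x)"
    by (intro has_derivative_add has_derivative_deriv_at dL)
  then have "((\<lambda>y. L y (a + b)) has_derivative (\<lambda>d. deriv_at (\<lambda>y. L y a) x d + deriv_at (\<lambda>y. L y b) x d)) (at x)"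
    by (rule has_derivative_transform_within_open[OF _ S]) (simp add: linear_add[OF lin])
  then show "deriv_at (\<lambda>y. L y (a + b)) x d = deriv_at (\<lambda>y. L y a) x d + deriv_at (\<lambda>y. L y b) x d"
    by (rule deriv_at_eqI)
  have "((\<lambda>y. c *\<^sub>R L y a) has_derivative (\<lambda>d. c *\<^sub>R deriv_at (\<lambda>y. L y a) x d)) (at x)"
    by (intro has_derivative_scaleR_right has_derivative_deriv_at dL)
  then have "((\<lambda>y. L y (c *\<^sub>R a)) has_derivative (\<lambda>d. c *\<^sub>R deriv_at (\<lambda>y. L y a) x d)) (at x)"
    by (rule has_derivative_transform_within_open[OF _ S]) (simp add: linear_scale[OF lin])
  then show "deriv_at (\<lambda>y. L y (c *\<^sub>R a)) x d = c *\<^sub>R deriv_at (\<lambda>y. L y a) x d"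
    by (rule deriv_at_eqI)
qed

lemma has_derivative_bilinear_family:
  fixes B :: "'p::real_normed_vector \<Rightarrow> 'a::euclidean_space \<Rightarrow> 'b::euclidean_space \<Rightarrow> 'c::real_normed_vector"
  assumes U: "open U" "\<And>y. y \<in> S \<Longrightarrow> F y \<in> U" and S: "open S" "x \<in> S"
    and bil: "\<And>z. z \<in> U \<Longrightarrow> bilinear (B z)"
    and dB: "\<And>a b. (\<lambda>z. B z a b) differentiable (at (F x))"
    and F: "(F has_derivative F') (at x)"
    and V: "(V has_derivative V') (at x)" and W: "(W has_derivative W') (at x)"
  shows "((\<lambda>y. B (F y) (V y) (W y)) has_derivative
    (\<lambda>d. deriv_at (\<lambda>z. B z (V x) (W x)) (F x) (F' d) + B (F x) (V' d) (W x) + B (F x) (V x) (W' d))) (at x)"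
proof -
  have Fx: "F x \<in> U" using U S by simp
  have comp: "((\<lambda>y. B (F y) a b) has_derivative (\<lambda>d. deriv_at (\<lambda>z. B z a b) (F x) (F' d))) (at x)" for a b
    using diff_chain_at[OF F has_derivative_deriv_at[OF dB[of a b]]] by (simp add: o_def)
  have dF: "(\<lambda>y. B (F y) a b) differentiable (at x)" for a b
    using comp unfolding differentiable_def by blast
  have 1: "((\<lambda>y. B (F y) a (W y)) has_derivative
      (\<lambda>d. deriv_at (\<lambda>z. B z a (W x)) (F x) (F' d) + B (F x) a (W' d))) (at x)" for a
    using has_derivative_linear_family[where L = "\<lambda>y. B (F y) a", OF S _ dF W] bil U
    by (simp add: deriv_at_eqI[OF comp] bilinear_def)
  have d1: "(\<lambda>y. B (F y) a (W y)) differentiable (at x)" for a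
    using 1 unfolding differentiable_def by blast
  have "((\<lambda>y. (\<lambda>a. B (F y) a (W y)) (V y)) has_derivative
      (\<lambda>d. deriv_at (\<lambda>y. B (F y) (V x) (W y)) x d + B (F x) (V' d) (W x))) (at x)"
    using has_derivative_linear_family[where L = "\<lambda>y a. B (F y) a (W y)", OF S _ d1 V] bil U by (simp add: bilinear_def)
  then show ?thesis by (simp add: deriv_at_eqI[OF 1] algebra_simps)
qed

section \<open>The Levi-Civita connection and its curvature\<close>

locale metric_domain =
  fixes U :: "'f::euclidean_space set" and G :: "'f metric"
  assumes open_domain: "open U" and metric_on: "metric_on U G"
begin

lemma metric_smooth: "smooth_on U (\<lambda>y. G y u v)"
  and metric_bilinear: "y \<in> U \<Longrightarrow> bilinear (G y)"
  and metric_sym: "y \<in> U \<Longrightarrow> G y u v = G y v u"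
  and metric_pos: "y \<in> U \<Longrightarrow> u \<noteq> 0 \<Longrightarrow> G y u u > 0"
  using metric_on by (auto simp: metric_on_def)

lemma metric_differentiable: "y \<in> U \<Longrightarrow> (\<lambda>z. G z u v) differentiable (at y)"
  using metric_smooth smooth_on_imp_differentiable by blast

lemma metric_linear: "y \<in> U \<Longrightarrow> linear (G y u)" "y \<in> U \<Longrightarrow> linear (\<lambda>u. G y u v)"
  using metric_bilinear by (auto simp: bilinear_def)

lemmas metric_simps =
  linear_add[OF metric_linear(1)] linear_add[OF metric_linear(2)]
  linear_diff[OF metric_linear(1)] linear_diff[OF metric_linear(2)]
  linear_scale[OF metric_linear(1)] linear_scale[OF metric_linear(2)]
  linear_0[OF metric_linear(1)] linear_0[OF metric_linear(2)]
  linear_sum[OF metric_linear(1)] linear_sum[OF metric_linear(2)]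
  linear_neg[OF metric_linear(1)] linear_neg[OF metric_linear(2)]

lemma metric_nonneg: "y \<in> U \<Longrightarrow> G y u u \<ge> 0"
  using metric_pos[of y u] metric_simps(7)[of y u] by (cases "u = 0") auto

lemma metric_eqI:
  assumes y: "y \<in> U" and eq: "\<And>z. G y v z = G y w z"
  shows "v = w"
proof (rule ccontr)
  assume "v \<noteq> w"
  then have "G y (v - w) (v - w) > 0" using metric_pos[OF y] by simp
  then show False using eq by (simp add: metric_simps y)
qed

lemma metric_representation:
  assumes y: "y \<in> U" and k: "linear k"
  shows "\<exists>!w. \<forall>z. G y w z = k z"
proof -
  let ?T = "\<lambda>w. \<Sum>b\<in>Basis. G y w b *\<^sub>R b"
  have l: "linear ?T"
    by (rule linearI) (simp_all add: metric_simps y scaleR_add_left sum.distrib scaleR_sum_right)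
  have basis: "?T w \<bullet> b = G y w b" if "b \<in> Basis" for w b using that by simp
  have ext: "\<And>z. G y v z = j z" if "\<And>b. b \<in> Basis \<Longrightarrow> G y v b = j b" "linear j" for v j
    using linear_eq_stdbasis[OF metric_linear(1)[OF y] that(2,1)] by simp
  have "inj ?T"
  proof (rule injI)
    fix v w assume "?T v = ?T w"
    then have "G y v b = G y w b" if "b \<in> Basis" for b using basis[OF that] by metis
    then show "v = w" using ext[OF _ metric_linear(1)[OF y]] metric_eqI[OF y] by blast
  qed
  then have sj: "surj ?T" by (rule linear_inj_imp_surj[OF l])
  obtain w where "(\<Sum>b\<in>Basis. k b *\<^sub>R b) = ?T w"
    using surjD[OF sj, of "\<Sum>b\<in>Basis. k b *\<^sub>R b"] by blast
  then have w: "?T w = (\<Sum>b\<in>Basis. k b *\<^sub>R b)" ..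
  have "G y w b = k b" if "b \<in> Basis" for b
    using basis[OF that, of w] that unfolding w by simp
  then have "\<forall>z. G y w z = k z" using ext k by blast
  then show ?thesis using metric_eqI[OF y] by (intro ex1I[of _ w]) auto
qed

lemma metric_deriv_linear:
  assumes y: "y \<in> U"
  shows "linear (\<lambda>v. deriv_at (\<lambda>z. G z v w) y u)" "linear (\<lambda>w. deriv_at (\<lambda>z. G z v w) y u)"
    "linear (\<lambda>u. deriv_at (\<lambda>z. G z v w) y u)"
  by (intro linear_deriv_linear_family[OF open_domain y] metric_linear metric_differentiable y; assumption)+
     (intro linear_frechet_derivative metric_differentiable y)

lemma metric_deriv_sym:
  assumes y: "y \<in> U"
  shows "deriv_at (\<lambda>z. G z v w) y u = deriv_at (\<lambda>z. G z w v) y u"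
  by (rule deriv_at_cong[OF metric_differentiable[OF y] open_domain y metric_sym])

lemma christoffel_koszul:
  assumes y: "y \<in> U"
  shows "G y (christoffel G y u v) z =
    (deriv_at (\<lambda>y. G y v z) y u + deriv_at (\<lambda>y. G y u z) y v - deriv_at (\<lambda>y. G y u v) y z) / 2"
proof -
  have "linear (\<lambda>z. (deriv_at (\<lambda>y. G y v z) y u + deriv_at (\<lambda>y. G y u z) y v - deriv_at (\<lambda>y. G y u v) y z) / 2)"
    by (rule linearI)
      (simp_all add: linear_add[OF metric_deriv_linear(2)[OF y]] linear_add[OF metric_deriv_linear(3)[OF y]]
        linear_scale[OF metric_deriv_linear(2)[OF y]] linear_scale[OF metric_deriv_linear(3)[OF y]] algebra_simps
        add_divide_distrib diff_divide_distrib)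
  from theI'[OF metric_representation[OF y this]] show ?thesis unfolding christoffel_def by blast
qed

lemma christoffel_bilinear: assumes y: "y \<in> U" shows "bilinear (christoffel G y)"
  unfolding bilinear_def
  by (intro conjI allI linearI; rule metric_eqI[OF y];
      simp add: metric_simps y christoffel_koszul
        linear_add[OF metric_deriv_linear(1)[OF y]] linear_add[OF metric_deriv_linear(2)[OF y]]
        linear_add[OF metric_deriv_linear(3)[OF y]] linear_scale[OF metric_deriv_linear(1)[OF y]]
        linear_scale[OF metric_deriv_linear(2)[OF y]] linear_scale[OF metric_deriv_linear(3)[OF y]]
        algebra_simps add_divide_distrib diff_divide_distrib)

lemma christoffel_sym:
  assumes y: "y \<in> U"
  shows "christoffel G y u v = christoffel G y v u"
  by (rule metric_eqI[OF y]) (simp add: christoffel_koszul[OF y] metric_deriv_sym[OF y, of u v])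

text \<open>The Koszul formula, added to itself with \<open>u\<close> and \<open>v\<close> interchanged: the connection is metric.\<close>

lemma christoffel_metric:
  assumes y: "y \<in> U"
  shows "deriv_at (\<lambda>z. G z u v) y d = G y (christoffel G y d u) v + G y u (christoffel G y d v)"
  unfolding metric_sym[OF y, of u "christoffel G y d v"] christoffel_koszul[OF y]
  by (simp add: metric_deriv_sym[OF y, of v u] metric_deriv_sym[OF y, of d u]
      metric_deriv_sym[OF y, of d v] field_simps)

lemma christoffel_differentiable:
  assumes y: "y \<in> U"
  shows "(\<lambda>z. christoffel G z u v) differentiable (at y)"
proof (rule differentiable_solution[OF open_domain y metric_bilinear metric_pos metric_differentiable[OF y]])
  show "(\<lambda>y. (deriv_at (\<lambda>y. G y v z) y u + deriv_at (\<lambda>y. G y u z) y v - deriv_at (\<lambda>y. G y u v) y z) / 2)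
    differentiable (at y)" for z
    by (intro differentiable_divide differentiable_diff differentiable_add differentiable_const
        smooth_on_imp_differentiable[OF smooth_on_deriv[OF metric_smooth] y]) simp
qed (simp_all add: christoffel_koszul)

lemma christoffel_linear:
  assumes y: "y \<in> U"
  shows "linear (christoffel G y u)" "linear (\<lambda>u. christoffel G y u v)"
  using christoffel_bilinear[OF y] by (auto simp: bilinear_def)

lemmas christoffel_simps =
  linear_add[OF christoffel_linear(1)] linear_add[OF christoffel_linear(2)]
  linear_diff[OF christoffel_linear(1)] linear_diff[OF christoffel_linear(2)]
  linear_0[OF christoffel_linear(1)] linear_0[OF christoffel_linear(2)]

text \<open>The curvature tensor in coordinates. As a pointwise expression it is visibly tensorial, unlike
  \<open>curvature_op\<close>, with which it agrees on constant fields.\<close>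

definition riemann :: "'f \<Rightarrow> 'f \<Rightarrow> 'f \<Rightarrow> 'f \<Rightarrow> 'f" where
  "riemann y u v w =
     deriv_at (\<lambda>z. christoffel G z v w) y u + christoffel G y u (christoffel G y v w)
     - (deriv_at (\<lambda>z. christoffel G z u w) y v + christoffel G y v (christoffel G y u w))"

lemma curvature_op_constant:
  assumes y: "y \<in> U"
  shows "curvature_op G (\<lambda>_. u) (\<lambda>_. v) (\<lambda>_. w) y = riemann y u v w"
proof -
  have 1: "levi_civita G (\<lambda>_. a) (\<lambda>_. b) = (\<lambda>z. christoffel G z a b)" for a b
    by (simp add: levi_civita_def fun_eq_iff)
  have 2: "lie_bracket (\<lambda>_. u) (\<lambda>_. v) = (\<lambda>_. 0)" by (simp add: lie_bracket_def fun_eq_iff)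
  show ?thesis
    unfolding curvature_op_def 1 2
    by (simp add: levi_civita_def riemann_def christoffel_simps y)
qed

lemma christoffel_deriv_add:
  assumes y: "y \<in> U"
  shows "deriv_at (\<lambda>z. christoffel G z (u + u') v) y d
      = deriv_at (\<lambda>z. christoffel G z u v) y d + deriv_at (\<lambda>z. christoffel G z u' v) y d"
    "deriv_at (\<lambda>z. christoffel G z u (v + v')) y d
      = deriv_at (\<lambda>z. christoffel G z u v) y d + deriv_at (\<lambda>z. christoffel G z u v') y d"
    "deriv_at (\<lambda>z. christoffel G z u v) y (d + d')
      = deriv_at (\<lambda>z. christoffel G z u v) y d + deriv_at (\<lambda>z. christoffel G z u v) y d'"
  using linear_add[OF linear_deriv_linear_family[OF open_domain y christoffel_linear(2) christoffel_differentiable[OF y]]]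
    linear_add[OF linear_deriv_linear_family[OF open_domain y christoffel_linear(1) christoffel_differentiable[OF y]]]
    linear_add[OF linear_frechet_derivative[OF christoffel_differentiable[OF y]]]
  by simp_all

lemma riemann_add:
  assumes y: "y \<in> U"
  shows "riemann y (u + u') v w = riemann y u v w + riemann y u' v w"
    "riemann y u (v + v') w = riemann y u v w + riemann y u v' w"
    "riemann y u v (w + w') = riemann y u v w + riemann y u v w'"
  by (simp_all add: riemann_def christoffel_deriv_add y christoffel_simps)

lemma riemann_scaleR:
  assumes y: "y \<in> U"
  shows "riemann y u (k *\<^sub>R v) w = k *\<^sub>R riemann y u v w"
  using linear_scale[OF linear_deriv_linear_family[OF open_domain y christoffel_linear(2) christoffel_differentiable[OF y]]]
    linear_scale[OF linear_frechet_derivative[OF christoffel_differentiable[OF y]]]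
    linear_scale[OF christoffel_linear(1)[OF y]] linear_scale[OF christoffel_linear(2)[OF y]]
  by (simp add: riemann_def algebra_simps)

lemma riemann_swap: "riemann y v u w = - riemann y u v w"
  by (simp add: riemann_def)

lemma riemann_bianchi:
  assumes y: "y \<in> U"
  shows "riemann y u v w + riemann y v w u + riemann y w u v = 0"
proof -
  have "deriv_at (\<lambda>z. christoffel G z a b) y d = deriv_at (\<lambda>z. christoffel G z b a) y d" for a b d
    by (rule deriv_at_cong[OF christoffel_differentiable[OF y] open_domain y christoffel_sym])
  from this[of u v] this[of v w] this[of u w] show ?thesis
    unfolding riemann_def
    by (simp add: christoffel_sym[OF y, of u v] christoffel_sym[OF y, of v w] christoffel_sym[OF y, of u w])
qed

text \<open>Differentiate \<open>G(w, w)\<close> for a constant field \<open>w\<close> twice. The second derivatives are symmetric, and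
  their difference in the two orders is \<open>2 G(R(u, v) w, w)\<close>.\<close>

lemma riemann_skew:
  assumes y: "y \<in> U"
  shows "G y (riemann y u v w) w = 0"
proof -
  let ?f = "\<lambda>z. G z w w"
  have second: "deriv_at (\<lambda>z. deriv_at ?f z v) y u
      = 2 * (G y (deriv_at (\<lambda>z. christoffel G z v w) y u + christoffel G y u (christoffel G y v w)) w
         + G y (christoffel G y v w) (christoffel G y u w))" for u v
  proof -
    let ?c = "\<lambda>z. christoffel G z v w"
    have "((\<lambda>z. 2 * G z (?c z) w) has_derivative
        (\<lambda>d. 2 * (deriv_at (\<lambda>z. G z (?c y) w) y d + G y (deriv_at ?c y d) w + G y (?c y) 0))) (at y)"
      by (intro has_derivative_mult_right
          has_derivative_bilinear_family[where F = "\<lambda>z. z" and U = U and S = U]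
          open_domain y metric_bilinear metric_differentiable has_derivative_ident has_derivative_const
          has_derivative_deriv_at christoffel_differentiable)
    then have "((\<lambda>z. deriv_at ?f z v) has_derivative
        (\<lambda>d. 2 * (deriv_at (\<lambda>z. G z (?c y) w) y d + G y (deriv_at ?c y d) w + G y (?c y) 0))) (at y)"
      by (rule has_derivative_transform_within_open[OF _ open_domain y])
         (simp add: christoffel_metric metric_sym[of _ w])
    from deriv_at_eqI[OF this, of u] show ?thesis
      by (simp add: christoffel_metric[OF y] metric_simps y)
  qed
  have "deriv_at (\<lambda>z. deriv_at ?f z v) y u = deriv_at (\<lambda>z. deriv_at ?f z u) y v"
    by (rule second_derivative_symmetric[OF open_domain y metric_smooth])
  then show ?thesis
    unfolding second riemann_def
    by (simp add: metric_simps y metric_sym[OF y, of "christoffel G y u w" "christoffel G y v w"])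
qed

end

text \<open>Polarization of the sectional curvature. The pair symmetry follows from the Bianchi identity and
  turns \<open>Q a b b a = 0\<close> into \<open>Q a b c a = 0\<close>. Then \<open>Q\<close> is skew in all arguments, hence
  invariant under cyclic permutations of the first three, and the Bianchi identity reads \<open>3 Q = 0\<close>.\<close>

lemma curvature_tensor_zero:
  fixes Q :: "'a::real_vector \<Rightarrow> 'a \<Rightarrow> 'a \<Rightarrow> 'a \<Rightarrow> real"
  assumes add: "\<And>a a' b c d. Q (a + a') b c d = Q a b c d + Q a' b c d"
      "\<And>a b b' c d. Q a (b + b') c d = Q a b c d + Q a b' c d"
      "\<And>a b c c' d. Q a b (c + c') d = Q a b c d + Q a b c' d"
      "\<And>a b c d d'. Q a b c (d + d') = Q a b c d + Q a b c d'"
    and skew: "\<And>a b c d. Q b a c d = - Q a b c d" "\<And>a b c. Q a b c c = 0"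
    and bianchi: "\<And>a b c d. Q a b c d + Q b c a d + Q c a b d = 0"
    and sec: "\<And>a b. Q a b b a = 0"
  shows "Q a b c d = 0"
proof -
  have skew': "Q a b d c = - Q a b c d" for a b c d
  proof -
    have "Q a b c d + Q a b d c = 0" 
      using skew(2)[of a b "c + d"] skew(2)[of a b c] skew(2)[of a b d] unfolding add by linarith
    then show ?thesis by linarith
  qed
  have pair: "Q a b c d = Q c d a b" for a b c d
    using bianchi[of a b c d] bianchi[of b c d a] bianchi[of c d a b] bianchi[of d a b c]
      skew(1)[of a b c d] skew(1)[of a b d c] skew(1)[of b c] skew(1)[of c a] skew(1)[of c d] skew(1)[of d a]
      skew(1)[of d b] skew'[of a b c d] skew'[of b c a d] skew'[of c a b d] skew'[of c d a b]
      skew'[of d b c a] skew'[of d a b c] skew'[of d a c b] skew'[of b d a c] skew'[of a c b d]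
    by (smt (verit))
  have 1: "Q a b c a = 0" for a b c
    using sec[of a "b + c"] sec[of a b] sec[of a c] pair[of a c b a] skew(1)[of a b a c] skew'[of a b a c]
    unfolding add by linarith
  have 2: "Q d b c a = - Q a b c d" for a b c d
    using 1[of "a + d" b c] 1[of a b c] 1[of d b c] unfolding add by linarith
  have rot: "Q b c a d = Q a b c d" for a b c d
    using skew(1) skew' 2 by metis
  show ?thesis using bianchi[of a b c d] rot[of b c a d] rot[of a b c d] by linarith
qed

context metric_domain
begin

text \<open>Subtracting the curvature tensor of constant curvature \<open>c\<close> leaves a tensor without sectional
  curvatures. The hypothesis speaks of independent pairs only; on dependent pairs skew-symmetry
  takes over.\<close>

lemma riemann_constant_curvature:
  assumes y: "y \<in> U"
    and sec: "\<And>u v. u \<noteq> v \<Longrightarrow> independent {u, v} \<Longrightarrow> sectional_curvature G y u v = c"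
  shows "G y (riemann y u v w) z = c * (G y v w * G y u z - G y u w * G y v z)"
proof -
  define Q where "Q u v w z = G y (riemann y u v w) z - c * (G y v w * G y u z - G y u w * G y v z)" for u v w z
  have skew: "Q v u w z = - Q u v w z" "Q u v w w = 0" for u v w z
    by (simp_all add: Q_def riemann_swap[of y v u] metric_simps y riemann_skew algebra_simps)
  have "Q u v w z = 0"
  proof (rule curvature_tensor_zero[where Q = Q])
    show "Q a b c d + Q b c a d + Q c a b d = 0" for a b c d
    proof -
      have "G y (riemann y a b c) d + G y (riemann y b c a) d + G y (riemann y c a b) d = 0"
        using arg_cong[OF riemann_bianchi[OF y, of a b c], of "\<lambda>v. G y v d"] by (simp add: metric_simps y)
      then show ?thesis
        by (simp add: Q_def metric_sym[OF y, of c b] metric_sym[OF y, of c a] metric_sym[OF y, of b a] algebra_simps)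
    qed
    show "Q a b b a = 0" for a b
    proof (cases "b \<noteq> a \<and> independent {a, b}")
      case True
      let ?D = "G y a a * G y b b - (G y a b)\<^sup>2"
      have a0: "a \<noteq> 0" using True dependent_zero by auto
      \<comment> \<open>The denominator of the sectional curvature is positive, since \<open>G y w w\<close> is \<open>G y a a\<close> times it.\<close>
      define w where "w = G y a a *\<^sub>R b - G y a b *\<^sub>R a"
      have "b \<notin> span {a}" using True by (metis independent_insert insert_commute singletonD)
      have "w \<noteq> 0"
      proof
        assume "w = 0"
        have "b = (1 / G y a a) *\<^sub>R (G y a a *\<^sub>R b)" using metric_pos[OF y a0] by simp
        also have "\<dots> = (G y a b / G y a a) *\<^sub>R a" using \<open>w = 0\<close> by (simp add: w_def)
        finally show False using \<open>b \<notin> span {a}\<close> by (metis rangeI span_singleton)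
      qed
      from metric_pos[OF y this] have "0 < G y a a * ?D"
        by (simp add: w_def metric_simps y metric_sym[OF y, of b a] power2_eq_square algebra_simps)
      then have D: "?D > 0" using metric_pos[OF y a0] by (simp add: zero_less_mult_iff)
      have "G y (riemann y a b b) a / ?D = c"
        using sec[of a b] True
        by (auto simp: sectional_curvature_def curvature_def curvature_op_constant[OF y])
      then have "G y (riemann y a b b) a = c * ?D" using D by (simp add: divide_eq_eq)
      then show ?thesis
        by (simp add: Q_def metric_sym[OF y, of b a] power2_eq_square algebra_simps)
    next
      case False
      then consider "a = 0" | "b = a" | "b \<in> span {a}"
        by (auto simp: independent_insert insert_commute[of a b] split: if_splits)
      then show ?thesis
      proof cases
        case 1
        then show ?thesis by (simp add: Q_def metric_simps y)
      next
        case 2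
        then show ?thesis using skew(1)[of a a] by simp
      next
        case 3
        then obtain k where k: "b = k *\<^sub>R a" by (auto simp: span_singleton)
        have "riemann y a a e = 0" for e by (simp add: riemann_def)
        then show ?thesis
          by (simp add: Q_def k riemann_scaleR metric_simps y)
      qed
    qed
  next
    show "Q b a c d = - Q a b c d" "Q a b c c = 0" for a b c d by (rule skew)+
  qed (simp_all add: Q_def riemann_add y metric_simps algebra_simps)
  then show ?thesis by (simp add: Q_def)
qed

lemma orthonormal_expansion:
  assumes y: "y \<in> U" and I: "finite I" "card I = DIM('f)"
    and b: "\<And>i j. i \<in> I \<Longrightarrow> j \<in> I \<Longrightarrow> G y (b i) (b j) = (if i = j then 1 else 0)"
  shows "(\<Sum>i\<in>I. G y v (b i) *\<^sub>R b i) = v"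
proof -
  have inj: "inj_on b I"
  proof (rule inj_onI)
    fix i j assume "i \<in> I" "j \<in> I" "b i = b j"
    then show "i = j" using b[of i i] b[of i j] by (auto split: if_splits)
  qed
  have ind: "independent (b ` I)"
  proof (rule independent_if_scalars_zero)
    fix f and v assume s: "(\<Sum>x\<in>b ` I. f x *\<^sub>R x) = 0" and "v \<in> b ` I"
    then obtain j where j: "j \<in> I" "v = b j" by blast
    have "G y (\<Sum>i\<in>I. f (b i) *\<^sub>R b i) (b j) = (\<Sum>i\<in>I. f (b i) * G y (b i) (b j))"
      by (simp add: metric_simps y)
    also have "\<dots> = (\<Sum>i\<in>I. if i = j then f (b j) else 0)"
      using b j by (intro sum.cong) auto
    also have "\<dots> = f v" using I j by simp
    finally have "G y (\<Sum>i\<in>I. f (b i) *\<^sub>R b i) (b j) = f v" .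
    moreover have "(\<Sum>i\<in>I. f (b i) *\<^sub>R b i) = 0" using s by (simp add: sum.reindex[OF inj])
    ultimately show "f v = 0" by (simp only: metric_simps y)
  qed (use I in simp)
  have "dim (b ` I) = DIM('f)"
    using dim_eq_card_independent[OF ind] card_image[OF inj] I by simp
  then have "span (b ` I) = UNIV" by (simp add: dim_eq_full)
  then have v: "v \<in> span (b ` I)" by simp
  have l: "linear (\<lambda>v. \<Sum>i\<in>I. G y v (b i) *\<^sub>R b i)"
    by (rule linearI) (simp_all add: metric_simps y scaleR_add_left sum.distrib scaleR_sum_right)
  have "(\<Sum>i\<in>I. G y (b j) (b i) *\<^sub>R b i) = b j" if "j \<in> I" for j
  proof -
    have "(\<Sum>i\<in>I. G y (b j) (b i) *\<^sub>R b i) = (\<Sum>i\<in>I. if i = j then b j else 0)"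
      using b that by (intro sum.cong) auto
    then show ?thesis using I that by simp
  qed
  then show ?thesis
    using linear_eq_on_span[OF l linear_id _ v] by auto
qed

lemma bessel_inequality:
  assumes y: "y \<in> U" and I: "finite I"
    and b: "\<And>i j. i \<in> I \<Longrightarrow> j \<in> I \<Longrightarrow> G y (b i) (b j) = (if i = j then 1 else 0)"
  shows "(\<Sum>i\<in>I. (G y v (b i))\<^sup>2) \<le> G y v v"
proof -
  let ?p = "\<Sum>i\<in>I. G y v (b i) *\<^sub>R b i"
  have qp: "G y q ?p = (\<Sum>i\<in>I. G y v (b i) * G y q (b i))" for q by (simp add: metric_simps y)
  have vp: "G y v ?p = (\<Sum>i\<in>I. (G y v (b i))\<^sup>2)" by (simp add: qp power2_eq_square)
  have "G y ?p (b j) = G y v (b j)" if "j \<in> I" for j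
  proof -
    have "G y ?p (b j) = (\<Sum>i\<in>I. G y v (b i) * G y (b i) (b j))" by (simp add: metric_simps y)
    also have "\<dots> = (\<Sum>i\<in>I. if i = j then G y v (b j) else 0)"
      using b that by (intro sum.cong) auto
    finally show ?thesis using I that by simp
  qed
  then have pp: "G y ?p ?p = (\<Sum>i\<in>I. (G y v (b i))\<^sup>2)"
    unfolding qp[of ?p] by (simp add: power2_eq_square)
  have "0 \<le> G y (v - ?p) (v - ?p)" by (rule metric_nonneg[OF y])
  also have "\<dots> = G y v v - G y v ?p - (G y ?p v - G y ?p ?p)"
    by (simp only: metric_simps(3,4)[OF y])
  finally show ?thesis using vp pp metric_sym[OF y, of ?p v] by linarith
qed

lemma levi_civita_differentiable:
  assumes x: "x \<in> U" and Y: "smooth_on U Y" and Z: "smooth_on U Z"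
  shows "levi_civita G Y Z differentiable (at x)"
proof -
  have d: "Y differentiable (at x)" "Z differentiable (at x)"
    using Y Z x smooth_on_imp_differentiable by blast+
  have "(\<lambda>y. christoffel G y (Y y) (Z y)) differentiable (at x)"
    using has_derivative_bilinear_family[where F = "\<lambda>z. z" and U = U and S = U, OF open_domain _ open_domain x
        christoffel_bilinear christoffel_differentiable has_derivative_ident
        has_derivative_deriv_at[OF d(1)] has_derivative_deriv_at[OF d(2)]] x
    unfolding differentiable_def by blast
  moreover have "(\<lambda>y. deriv_at Z y (Y y)) differentiable (at x)"
    using smooth_on_imp_differentiable[OF smooth_on_deriv_field[OF open_domain Z Y] x] .
  ultimately show ?thesis unfolding levi_civita_def[abs_def] by (intro differentiable_add)
qed

end

section \<open>Vector fields along an immersion\<close>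

locale immersed_domain = metric_domain U G + source: metric_domain W g
  for U :: "'f::euclidean_space set" and G :: "'f metric"
    and W :: "'e::euclidean_space set" and g :: "'e metric" +
  fixes F :: "'e \<Rightarrow> 'f"
  assumes maps: "y \<in> W \<Longrightarrow> F y \<in> U" and immersion_smooth: "smooth_on W F"
    and isometry: "y \<in> W \<Longrightarrow> g y u v = G (F y) (deriv_at F y u) (deriv_at F y v)"
begin

abbreviation push :: "('e \<Rightarrow> 'e) \<Rightarrow> 'e \<Rightarrow> 'f" where
  "push X \<equiv> \<lambda>y. deriv_at F y (X y)"

abbreviation nabla :: "('e \<Rightarrow> 'e) \<Rightarrow> ('e \<Rightarrow> 'f) \<Rightarrow> 'e \<Rightarrow> 'f" where
  "nabla \<equiv> pullback_connection G F"

lemma F_derivative: "y \<in> W \<Longrightarrow> (F has_derivative deriv_at F y) (at y)"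
  by (rule has_derivative_deriv_at[OF smooth_on_imp_differentiable[OF immersion_smooth]])

lemma F_linear: "y \<in> W \<Longrightarrow> linear (deriv_at F y)"
  by (rule linear_frechet_derivative[OF smooth_on_imp_differentiable[OF immersion_smooth]])

lemma push_smooth: "smooth_on W X \<Longrightarrow> smooth_on W (push X)"
  by (rule smooth_on_deriv_field[OF source.open_domain immersion_smooth])

lemma metric_along_derivative:
  assumes x: "x \<in> W" and V: "V differentiable (at x)" "V' differentiable (at x)"
  shows "((\<lambda>y. G (F y) (V y) (V' y)) has_derivative (\<lambda>d.
    G (F x) (nabla (\<lambda>_. d) V x) (V' x) + G (F x) (V x) (nabla (\<lambda>_. d) V' x))) (at x)"
proof -
  have Fx: "F x \<in> U" using x by (rule maps)
  have "(\<lambda>d. deriv_at (\<lambda>z. G z (V x) (V' x)) (F x) (deriv_at F x d)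
        + G (F x) (deriv_at V x d) (V' x) + G (F x) (V x) (deriv_at V' x d))
      = (\<lambda>d. G (F x) (nabla (\<lambda>_. d) V x) (V' x) + G (F x) (V x) (nabla (\<lambda>_. d) V' x))"
    by (rule ext) (simp add: pullback_connection_def christoffel_metric[OF Fx] metric_simps Fx)
  moreover have "((\<lambda>y. G (F y) (V y) (V' y)) has_derivative
      (\<lambda>d. deriv_at (\<lambda>z. G z (V x) (V' x)) (F x) (deriv_at F x d)
        + G (F x) (deriv_at V x d) (V' x) + G (F x) (V x) (deriv_at V' x d))) (at x)"
    by (rule has_derivative_bilinear_family[where U = U and S = W])
      (use open_domain source.open_domain x maps metric_bilinear metric_differentiable[OF Fx] F_derivative[OF x]
        has_derivative_deriv_at[OF V(1)] has_derivative_deriv_at[OF V(2)] in auto)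
  ultimately show ?thesis by simp
qed

lemma nabla_field: "nabla X V x = nabla (\<lambda>_. X x) V x"
  by (simp add: pullback_connection_def)

lemma nabla_orthogonal:
  assumes x: "x \<in> W" and V: "V differentiable (at x)" "V' differentiable (at x)"
    and ortho: "\<And>y. y \<in> W \<Longrightarrow> G (F y) (V y) (V' y) = 0"
  shows "G (F x) (nabla X V x) (V' x) = - G (F x) (V x) (nabla X V' x)"
proof -
  have "((\<lambda>y. 0) has_derivative (\<lambda>d.
    G (F x) (nabla (\<lambda>_. d) V x) (V' x) + G (F x) (V x) (nabla (\<lambda>_. d) V' x))) (at x)"
    by (rule has_derivative_transform_within_open[OF metric_along_derivative[OF x V] source.open_domain x ortho])
  from deriv_at_eqI[OF this, of "X x"] show ?thesis
    by (simp add: nabla_field[of X V] nabla_field[of X V'])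
qed

lemma nabla_diff:
  assumes x: "x \<in> W" and V: "V differentiable (at x)" "V' differentiable (at x)"
  shows "nabla X (\<lambda>y. V y - V' y) x = nabla X V x - nabla X V' x"
  using deriv_at_eqI[OF has_derivative_diff[OF has_derivative_deriv_at[OF V(1)] has_derivative_deriv_at[OF V(2)]]]
  by (simp add: pullback_connection_def christoffel_simps maps[OF x])

lemma nabla_cong:
  assumes x: "x \<in> W" and V: "V differentiable (at x)" and eq: "\<And>y. y \<in> W \<Longrightarrow> V y = V' y"
  shows "nabla X V' x = nabla X V x"
  using deriv_at_cong[OF V source.open_domain x eq] eq[OF x]
  by (simp add: pullback_connection_def)

lemma push_derivative:
  assumes x: "x \<in> W" and Y: "Y differentiable (at x)"
  shows "(push Y has_derivative (\<lambda>d. deriv_at (\<lambda>y. deriv_at F y (Y x)) x d + deriv_at F x (deriv_at Y x d))) (at x)"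
  by (rule has_derivative_linear_family[OF source.open_domain x F_linear
      smooth_on_imp_differentiable[OF smooth_on_deriv[OF immersion_smooth] x] has_derivative_deriv_at[OF Y]])

lemma push_differentiable: "x \<in> W \<Longrightarrow> Y differentiable (at x) \<Longrightarrow> push Y differentiable (at x)"
  using push_derivative unfolding differentiable_def by blast

text \<open>The covariant Hessian of the immersion. Its tangential part is the intrinsic Christoffel symbol
  and its normal part the second fundamental form.\<close>

definition hess :: "'e \<Rightarrow> 'e \<Rightarrow> 'e \<Rightarrow> 'f" where
  "hess x u v = nabla (\<lambda>_. u) (push (\<lambda>_. v)) x"

lemma nabla_push:
  assumes x: "x \<in> W" and Y: "Y differentiable (at x)"
  shows "nabla X (push Y) x = hess x (X x) (Y x) + deriv_at F x (deriv_at Y x (X x))"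
  using deriv_at_eqI[OF push_derivative[OF x Y]] by (simp add: pullback_connection_def hess_def)

lemma hess_sym:
  assumes x: "x \<in> W"
  shows "hess x u v = hess x v u"
  using second_derivative_symmetric[OF source.open_domain x immersion_smooth, of u v]
  by (simp add: hess_def pullback_connection_def christoffel_sym[OF maps[OF x], of "deriv_at F x u"])

text \<open>Differentiating the isometry condition expresses the derivatives of \<open>g\<close> through \<open>hess\<close>. In the
  Koszul formula for \<open>g\<close> all terms but one then cancel, because \<open>hess\<close> is symmetric.\<close>

lemma hess_tangential:
  assumes x: "x \<in> W"
  shows "G (F x) (hess x u v) (deriv_at F x z) = g x (christoffel g x u v) z"
proof -
  have Fx: "F x \<in> U" using x by (rule maps)
  have dg: "deriv_at (\<lambda>y. g y a b) x d
      = G (F x) (hess x d a) (deriv_at F x b) + G (F x) (deriv_at F x a) (hess x d b)" for a b d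
  proof -
    have "((\<lambda>y. G (F y) (deriv_at F y a) (deriv_at F y b)) has_derivative (\<lambda>d.
      G (F x) (hess x d a) (deriv_at F x b) + G (F x) (deriv_at F x a) (hess x d b))) (at x)"
      using metric_along_derivative[OF x, of "push (\<lambda>_. a)" "push (\<lambda>_. b)"] push_differentiable[OF x]
      by (simp add: hess_def)
    then have "((\<lambda>y. g y a b) has_derivative (\<lambda>d.
      G (F x) (hess x d a) (deriv_at F x b) + G (F x) (deriv_at F x a) (hess x d b))) (at x)"
      by (rule has_derivative_transform_within_open[OF _ source.open_domain x]) (simp add: isometry)
    then show ?thesis by (rule deriv_at_eqI)
  qed
  show ?thesis
    unfolding source.christoffel_koszul[OF x] dg
    by (simp add: hess_sym[OF x, of z] hess_sym[OF x, of v u] metric_sym[OF Fx, of "deriv_at F x _"])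
qed

lemma nabla_push_tangential:
  assumes x: "x \<in> W" and Y: "Y differentiable (at x)"
  shows "G (F x) (nabla X (push Y) x) (deriv_at F x z) = G (F x) (push (levi_civita g X Y) x) (deriv_at F x z)"
  using hess_tangential[OF x]
  by (simp add: nabla_push[OF x Y] levi_civita_def metric_simps maps[OF x] linear_add[OF F_linear[OF x]]
      isometry[OF x])

lemma nabla_torsion:
  assumes x: "x \<in> W" and X: "X differentiable (at x)" and Y: "Y differentiable (at x)"
  shows "nabla X (push Y) x - nabla Y (push X) x = push (lie_bracket X Y) x"
  by (simp add: nabla_push[OF x] X Y hess_sym[OF x, of "Y x"] lie_bracket_def linear_diff[OF F_linear[OF x]])

text \<open>Two candidates differ by a vector that is both normal and tangential, hence by 0.\<close>

lemma normal_part_eq: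
  assumes x: "x \<in> W" and v: "is_normal G F x v" and w: "w - v \<in> range (deriv_at F x)"
  shows "normal_part G F x w = v"
  unfolding normal_part_def
proof (rule the_equality)
  fix v' assume v': "is_normal G F x v' \<and> w - v' \<in> range (deriv_at F x)"
  then obtain a b where ab: "w - v = deriv_at F x a" "w - v' = deriv_at F x b" using w by blast
  then have d: "v' - v = deriv_at F x (a - b)"
    by (simp add: linear_diff[OF F_linear[OF x]] flip: ab)
  have "G (F x) (v' - v) (deriv_at F x (a - b)) = 0"
    using v v' by (simp add: is_normal_def metric_simps maps[OF x])
  then show "v' = v" using metric_pos[OF maps[OF x], of "v' - v"] by (simp flip: d) force
qed (use v w in simp)

lemma second_fundamental_form_eq:
  assumes x: "x \<in> W" and Y: "Y differentiable (at x)"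
  shows "second_fundamental_form G F X Y x = nabla X (push Y) x - push (levi_civita g X Y) x"
  unfolding second_fundamental_form_def
  by (rule normal_part_eq[OF x])
    (simp_all add: is_normal_def metric_simps maps[OF x] nabla_push_tangential[OF x Y])

lemma second_fundamental_form_normal:
  assumes x: "x \<in> W" and Y: "Y differentiable (at x)"
  shows "G (F x) (second_fundamental_form G F X Y x) (deriv_at F x z) = 0"
  by (simp add: second_fundamental_form_eq[OF x Y] metric_simps maps[OF x] nabla_push_tangential[OF x Y])

lemma second_fundamental_form_pairing:
  assumes x: "x \<in> W" and Y: "Y differentiable (at x)" and v: "is_normal G F x v"
  shows "G (F x) v (second_fundamental_form G F X Y x) = G (F x) v (nabla X (push Y) x)"
  using v by (simp add: second_fundamental_form_eq[OF x Y] metric_simps maps[OF x] is_normal_def)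

lemma second_fundamental_form_sym:
  assumes x: "x \<in> W" and X: "X differentiable (at x)" and Y: "Y differentiable (at x)"
  shows "second_fundamental_form G F X Y x = second_fundamental_form G F Y X x"
proof -
  have "levi_civita g X Y x - levi_civita g Y X x = lie_bracket X Y x"
    by (simp add: levi_civita_def lie_bracket_def source.christoffel_sym[OF x, of "X x"])
  then have "push (levi_civita g X Y) x - push (levi_civita g Y X) x = push (lie_bracket X Y) x"
    by (simp flip: linear_diff[OF F_linear[OF x]])
  then show ?thesis
    using nabla_torsion[OF x X Y] by (simp add: second_fundamental_form_eq[OF x] X Y algebra_simps)
qed

lemma nabla_derivative:
  assumes x: "x \<in> W" and Y: "Y differentiable (at x)" and V: "smooth_on W V"
  shows "(nabla Y V has_derivative (\<lambda>d.
    (deriv_at (\<lambda>y. deriv_at V y (Y x)) x d + deriv_at V x (deriv_at Y x d)) +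
    (deriv_at (\<lambda>z. christoffel G z (push Y x) (V x)) (F x) (deriv_at F x d)
      + christoffel G (F x) (deriv_at (\<lambda>y. deriv_at F y (Y x)) x d + deriv_at F x (deriv_at Y x d)) (V x)
      + christoffel G (F x) (push Y x) (deriv_at V x d)))) (at x)"
  unfolding pullback_connection_def[abs_def]
proof (rule has_derivative_add)
  have dV: "y \<in> W \<Longrightarrow> V differentiable (at y)" for y using V smooth_on_imp_differentiable by blast
  show "((\<lambda>y. deriv_at V y (Y y)) has_derivative
      (\<lambda>d. deriv_at (\<lambda>y. deriv_at V y (Y x)) x d + deriv_at V x (deriv_at Y x d))) (at x)"
    by (rule has_derivative_linear_family[OF source.open_domain x linear_frechet_derivative[OF dV]
      smooth_on_imp_differentiable[OF smooth_on_deriv[OF V] x] has_derivative_deriv_at[OF Y]])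
  show "((\<lambda>y. christoffel G (F y) (push Y y) (V y)) has_derivative (\<lambda>d.
      deriv_at (\<lambda>z. christoffel G z (push Y x) (V x)) (F x) (deriv_at F x d)
      + christoffel G (F x) (deriv_at (\<lambda>y. deriv_at F y (Y x)) x d + deriv_at F x (deriv_at Y x d)) (V x)
      + christoffel G (F x) (push Y x) (deriv_at V x d))) (at x)"
    by (rule has_derivative_bilinear_family[where U = U and S = W, OF open_domain maps source.open_domain x
        christoffel_bilinear christoffel_differentiable[OF maps[OF x]] F_derivative[OF x] push_derivative[OF x Y]
        has_derivative_deriv_at[OF dV[OF x]]])
qed

lemma nabla_differentiable:
  "x \<in> W \<Longrightarrow> Y differentiable (at x) \<Longrightarrow> smooth_on W V \<Longrightarrow> nabla Y V differentiable (at x)"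
  using nabla_derivative unfolding differentiable_def by blast

text \<open>The curvature of the pulled-back connection is the pull-back of the curvature. All terms with
  derivatives of \<open>X\<close> and \<open>Y\<close> are absorbed by the bracket, and the second derivatives of \<open>V\<close> and of the
  immersion cancel by symmetry.\<close>

lemma nabla_curvature:
  assumes x: "x \<in> W" and X: "X differentiable (at x)" and Y: "Y differentiable (at x)" and V: "smooth_on W V"
  shows "nabla X (nabla Y V) x - nabla Y (nabla X V) x - nabla (lie_bracket X Y) V x
    = riemann (F x) (push X x) (push Y x) (V x)"
proof -
  have Fx: "F x \<in> U" using x by (rule maps)
  have lV: "linear (deriv_at V x)"
    using V x smooth_on_imp_differentiable linear_frechet_derivative by blast
  have n: "nabla X (nabla Y V) x = deriv_at (nabla Y V) x (X x) + christoffel G (F x) (push X x) (nabla Y V x)" for X Y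
    by (simp add: pullback_connection_def)
  show ?thesis
    unfolding n deriv_at_eqI[OF nabla_derivative[OF x X V]] deriv_at_eqI[OF nabla_derivative[OF x Y V]]
      pullback_connection_def riemann_def lie_bracket_def
    using second_derivative_symmetric[OF source.open_domain x V, of "X x" "Y x"]
      second_derivative_symmetric[OF source.open_domain x immersion_smooth, of "X x" "Y x"]
    by (simp add: christoffel_simps Fx linear_diff[OF lV] linear_diff[OF F_linear[OF x]] algebra_simps)
qed

section \<open>The Gauss and Ricci equations\<close>

lemma second_fundamental_form_is_normal:
  "x \<in> W \<Longrightarrow> Y differentiable (at x) \<Longrightarrow> is_normal G F x (second_fundamental_form G F X Y x)"
  by (simp add: is_normal_def second_fundamental_form_normal)

text \<open>Replace the intrinsic second derivative \<open>\<nabla>\<^sub>X \<nabla>\<^sub>Y Z\<close> by the ambient one. The error is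
  the tangential part of the derivative of the normal field \<open>h(Y, Z)\<close>, and moving this derivative to
  the other factor gives \<open>\<langle>h(Y, Z), h(X, V)\<rangle>\<close>.\<close>

lemma gauss_equation:
  assumes x: "x \<in> W"
    and sm: "smooth_on W X" "smooth_on W Y" "smooth_on W Z" "smooth_on W V"
  shows "curvature g X Y Z V x
    = G (F x) (riemann (F x) (push X x) (push Y x) (push Z x)) (push V x)
      + G (F x) (second_fundamental_form G F Y Z x) (second_fundamental_form G F X V x)
      - G (F x) (second_fundamental_form G F X Z x) (second_fundamental_form G F Y V x)"
proof -
  have Fx: "F x \<in> U" using x by (rule maps)
  have diff: "A differentiable (at y)" if "smooth_on W A" "y \<in> W" for A :: "'e \<Rightarrow> 'e" and y
    using that smooth_on_imp_differentiable by blast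
  let ?h = "second_fundamental_form G F"
  have second: "G (F x) (push (levi_civita g X (levi_civita g Y Z)) x) (push V x)
      = G (F x) (nabla X (nabla Y (push Z)) x) (push V x) + G (F x) (?h Y Z x) (?h X V x)"
    if X: "smooth_on W X" and Y: "smooth_on W Y" for X Y
  proof -
    let ?L = "levi_civita g Y Z"
    have dL: "?L differentiable (at x)" by (rule source.levi_civita_differentiable[OF x Y sm(3)])
    have dP: "push ?L differentiable (at x)" by (rule push_differentiable[OF x dL])
    have dN: "nabla Y (push Z) differentiable (at x)"
      by (rule nabla_differentiable[OF x diff[OF Y x] push_smooth[OF sm(3)]])
    have h: "?h Y Z y = nabla Y (push Z) y - push ?L y" if "y \<in> W" for y
      by (rule second_fundamental_form_eq[OF that diff[OF sm(3) that]])
    have dh: "?h Y Z differentiable (at x)"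
      by (rule differentiable_cong[OF differentiable_diff[OF dN dP] source.open_domain x]) (simp add: h)
    have "nabla X (push ?L) x = nabla X (\<lambda>y. nabla Y (push Z) y - ?h Y Z y) x"
      by (rule nabla_cong[OF x differentiable_diff[OF dN dh]]) (simp add: h)
    also have "\<dots> = nabla X (nabla Y (push Z)) x - nabla X (?h Y Z) x"
      by (rule nabla_diff[OF x dN dh])
    finally have n: "nabla X (push ?L) x = nabla X (nabla Y (push Z)) x - nabla X (?h Y Z) x" .
    have "G (F x) (nabla X (?h Y Z) x) (push V x) = - G (F x) (?h Y Z x) (nabla X (push V) x)"
      by (rule nabla_orthogonal[OF x dh push_differentiable[OF x diff[OF sm(4) x]]])
         (rule second_fundamental_form_normal[OF _ diff[OF sm(3)]])
    also have "G (F x) (?h Y Z x) (nabla X (push V) x) = G (F x) (?h Y Z x) (?h X V x)"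
      using second_fundamental_form_pairing[OF x diff[OF sm(4) x]
          second_fundamental_form_is_normal[OF x diff[OF sm(3) x]]] by simp
    finally show ?thesis
      using nabla_push_tangential[OF x dL, of X "V x"] unfolding n by (simp add: metric_simps Fx)
  qed
  have "curvature g X Y Z V x = G (F x) (push (curvature_op g X Y Z) x) (push V x)"
    by (simp add: curvature_def isometry[OF x])
  also have "\<dots> = G (F x) (push (levi_civita g X (levi_civita g Y Z)) x) (push V x)
      - G (F x) (push (levi_civita g Y (levi_civita g X Z)) x) (push V x)
      - G (F x) (push (levi_civita g (lie_bracket X Y) Z) x) (push V x)"
    by (simp add: curvature_op_def linear_diff[OF F_linear[OF x]] metric_simps Fx)
  also have "\<dots> = G (F x) (nabla X (nabla Y (push Z)) x - nabla Y (nabla X (push Z)) x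
      - nabla (lie_bracket X Y) (push Z) x) (push V x)
      + G (F x) (?h Y Z x) (?h X V x) - G (F x) (?h X Z x) (?h Y V x)"
    unfolding second[OF sm(1,2)] second[OF sm(2,1)] nabla_push_tangential[OF x diff[OF sm(3) x], symmetric]
    by (simp add: metric_simps Fx)
  finally show ?thesis
    unfolding nabla_curvature[OF x diff[OF sm(1) x] diff[OF sm(2) x] push_smooth[OF sm(3)]] .
qed

end

locale framed_immersion = immersed_domain U G W g F
  for U :: "'f::euclidean_space set" and G W and g :: "'e::euclidean_space metric" and F +
  fixes n :: nat and e :: "nat \<Rightarrow> 'e \<Rightarrow> 'e"
  assumes dim: "DIM('e) = n" and frame: "tangent_frame_on n W g e"
begin

lemma frame_smooth: "i \<in> {1..n} \<Longrightarrow> smooth_on W (e i)"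
  and frame_orthonormal: "y \<in> W \<Longrightarrow> i \<in> {1..n} \<Longrightarrow> j \<in> {1..n} \<Longrightarrow> g y (e i y) (e j y) = (if i = j then 1 else 0)"
  using frame by (auto simp: tangent_frame_on_def)

lemma frame_differentiable: "i \<in> {1..n} \<Longrightarrow> y \<in> W \<Longrightarrow> e i differentiable (at y)"
  using frame_smooth smooth_on_imp_differentiable by blast

text \<open>The definition of \<open>normal_part\<close> says nothing about dependence on the point. The orthogonal
  projection along a smooth frame does, and makes the normal derivative of a normal field
  differentiable.\<close>

lemma normal_part_frame:
  assumes y: "y \<in> W"
  defines "p w \<equiv> \<Sum>i\<in>{1..n}. G (F y) w (push (e i) y) *\<^sub>R push (e i) y"
  shows "normal_part G F y w = w - p w"
proof (rule normal_part_eq[OF y])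
  have Fy: "F y \<in> U" using y by (rule maps)
  have tang: "p w = deriv_at F y (\<Sum>i\<in>{1..n}. G (F y) w (push (e i) y) *\<^sub>R e i y)"
    by (simp add: p_def linear_sum[OF F_linear[OF y]] linear_scale[OF F_linear[OF y]])
  then show "w - (w - p w) \<in> range (deriv_at F y)" by simp
  have "G (F y) (p w) (deriv_at F y u) = G (F y) w (deriv_at F y u)" for u
  proof -
    have "G (F y) (p w) (deriv_at F y u) = (\<Sum>i\<in>{1..n}. G (F y) w (push (e i) y) * g y u (e i y))"
      by (simp add: p_def metric_simps Fy isometry[OF y] metric_sym[OF Fy, of "deriv_at F y u"])
    also have "\<dots> = G (F y) w (deriv_at F y (\<Sum>i\<in>{1..n}. g y u (e i y) *\<^sub>R e i y))"
      by (simp add: linear_sum[OF F_linear[OF y]] linear_scale[OF F_linear[OF y]] metric_simps Fy mult.commute)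
    also have "(\<Sum>i\<in>{1..n}. g y u (e i y) *\<^sub>R e i y) = u"
      by (rule source.orthonormal_expansion[OF y]) (simp_all add: dim frame_orthonormal[OF y])
    finally show ?thesis .
  qed
  then show "is_normal G F y (w - p w)" by (simp add: is_normal_def metric_simps Fy)
qed

lemma normal_part_pairing:
  assumes y: "y \<in> W" and v: "is_normal G F y v"
  shows "G (F y) (normal_part G F y w) v = G (F y) w v"
  using v by (simp add: normal_part_frame[OF y] metric_simps maps[OF y] is_normal_def
      metric_sym[OF maps[OF y], of "deriv_at F y _" v])

text \<open>Dual to the Gauss equation: the error is now the normal part of the derivative of the tangential
  field \<open>T\<close>, whose components in the frame are \<open>- \<langle>\<xi>, h(Y, e\<^sub>i)\<rangle>\<close>.\<close>

lemma ricci_equation: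
  assumes x: "x \<in> W" and sm: "smooth_on W X" "smooth_on W Y" "smooth_on W \<xi>" "smooth_on W \<eta>"
    and nor: "\<And>y. y \<in> W \<Longrightarrow> is_normal G F y (\<xi> y)" "\<And>y. y \<in> W \<Longrightarrow> is_normal G F y (\<eta> y)"
  defines "h \<equiv> second_fundamental_form G F"
  shows "G (F x) (normal_curvature_op G F X Y \<xi> x) (\<eta> x)
    = G (F x) (riemann (F x) (push X x) (push Y x) (\<xi> x)) (\<eta> x)
      + (\<Sum>i\<in>{1..n}. G (F x) (\<xi> x) (h Y (e i) x) * G (F x) (\<eta> x) (h X (e i) x))
      - (\<Sum>i\<in>{1..n}. G (F x) (\<xi> x) (h X (e i) x) * G (F x) (\<eta> x) (h Y (e i) x))"
proof -
  have Fx: "F x \<in> U" using x by (rule maps)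
  have diff: "A differentiable (at x)" if "smooth_on W A" for A :: "'e \<Rightarrow> 'e"
    using that x smooth_on_imp_differentiable by blast
  have diff': "A differentiable (at x)" if "smooth_on W A" for A :: "'e \<Rightarrow> 'f"
    using that x smooth_on_imp_differentiable by blast
  have second: "G (F x) (normal_connection G F X (normal_connection G F Y \<xi>) x) (\<eta> x)
      = G (F x) (nabla X (nabla Y \<xi>) x) (\<eta> x)
        + (\<Sum>i\<in>{1..n}. G (F x) (\<xi> x) (h Y (e i) x) * G (F x) (\<eta> x) (h X (e i) x))"
    if X: "smooth_on W X" and Y: "smooth_on W Y" for X Y
  proof -
    let ?N = "normal_connection G F Y \<xi>"
    define T where "T y = (\<Sum>i\<in>{1..n}. G (F y) (nabla Y \<xi> y) (push (e i) y) *\<^sub>R push (e i) y)" for y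
    have N: "?N y = nabla Y \<xi> y - T y" if "y \<in> W" for y
      by (simp add: normal_connection_def normal_part_frame[OF that] T_def)
    have dD: "nabla Y \<xi> differentiable (at x)" by (rule nabla_differentiable[OF x diff[OF Y] sm(3)])
    have dp: "i \<in> {1..n} \<Longrightarrow> push (e i) differentiable (at x)" for i
      by (rule diff'[OF push_smooth[OF frame_smooth]])
    have dT: "T differentiable (at x)"
    proof -
      have "(\<lambda>y. G (F y) (nabla Y \<xi> y) (push (e i) y)) differentiable (at x)" if "i \<in> {1..n}" for i
        using metric_along_derivative[OF x dD dp[OF that]] unfolding differentiable_def by blast
      then show ?thesis
        unfolding T_def by (intro differentiable_sum ballI differentiable_scaleR dp) auto
    qed
    have "nabla X ?N x = nabla X (\<lambda>y. nabla Y \<xi> y - T y) x"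
      by (rule nabla_cong[OF x differentiable_diff[OF dD dT]]) (simp add: N)
    also have "\<dots> = nabla X (nabla Y \<xi>) x - nabla X T x" by (rule nabla_diff[OF x dD dT])
    finally have n: "nabla X ?N x = nabla X (nabla Y \<xi>) x - nabla X T x" .
    have "G (F x) (nabla X T x) (\<eta> x) = - G (F x) (T x) (nabla X \<eta> x)"
    proof (rule nabla_orthogonal[OF x dT diff'[OF sm(4)]])
      fix y assume y: "y \<in> W"
      then show "G (F y) (T y) (\<eta> y) = 0"
        using nor(2)[OF y]
        by (simp add: T_def metric_simps maps is_normal_def metric_sym[OF maps[OF y], of "deriv_at F y _"])
    qed
    also have "G (F x) (T x) (nabla X \<eta> x)
        = (\<Sum>i\<in>{1..n}. G (F x) (\<xi> x) (h Y (e i) x) * G (F x) (\<eta> x) (h X (e i) x))"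
    proof -
      have weingarten: "G (F x) (nabla Z \<zeta> x) (push (e i) x) = - G (F x) (\<zeta> x) (h Z (e i) x)"
        if i: "i \<in> {1..n}" and \<zeta>: "smooth_on W \<zeta>" "\<And>y. y \<in> W \<Longrightarrow> is_normal G F y (\<zeta> y)" for i \<zeta> Z
        unfolding h_def second_fundamental_form_pairing[OF x frame_differentiable[OF i x] \<zeta>(2)[OF x]]
        by (rule nabla_orthogonal[OF x diff'[OF \<zeta>(1)] dp[OF i]]) (use \<zeta>(2) in \<open>simp add: is_normal_def\<close>)
      have "G (F x) (T x) (nabla X \<eta> x)
          = (\<Sum>i\<in>{1..n}. G (F x) (nabla Y \<xi> x) (push (e i) x) * G (F x) (nabla X \<eta> x) (push (e i) x))"
        by (simp add: T_def metric_simps Fx metric_sym[OF Fx, of "nabla X \<eta> x"])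
      also have "\<dots> = (\<Sum>i\<in>{1..n}. G (F x) (\<xi> x) (h Y (e i) x) * G (F x) (\<eta> x) (h X (e i) x))"
        by (intro sum.cong refl) (simp add: weingarten sm nor)
      finally show ?thesis .
    qed
    finally have T: "G (F x) (nabla X T x) (\<eta> x)
        = - (\<Sum>i\<in>{1..n}. G (F x) (\<xi> x) (h Y (e i) x) * G (F x) (\<eta> x) (h X (e i) x))" .
    have "G (F x) (normal_connection G F X ?N x) (\<eta> x) = G (F x) (nabla X ?N x) (\<eta> x)"
      unfolding normal_connection_def[of G F X] by (rule normal_part_pairing[OF x nor(2)[OF x]])
    then show ?thesis unfolding n using T by (simp add: metric_simps Fx)
  qed
  have third: "G (F x) (normal_connection G F Z \<xi> x) (\<eta> x) = G (F x) (nabla Z \<xi> x) (\<eta> x)" for Z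
    unfolding normal_connection_def by (rule normal_part_pairing[OF x nor(2)[OF x]])
  have "G (F x) (normal_curvature_op G F X Y \<xi> x) (\<eta> x)
    = G (F x) (normal_connection G F X (normal_connection G F Y \<xi>) x) (\<eta> x)
      - G (F x) (normal_connection G F Y (normal_connection G F X \<xi>) x) (\<eta> x)
      - G (F x) (normal_connection G F (lie_bracket X Y) \<xi> x) (\<eta> x)"
    by (simp add: normal_curvature_op_def metric_simps Fx)
  also have "\<dots> = G (F x) (nabla X (nabla Y \<xi>) x - nabla Y (nabla X \<xi>) x - nabla (lie_bracket X Y) \<xi> x) (\<eta> x)
      + (\<Sum>i\<in>{1..n}. G (F x) (\<xi> x) (h Y (e i) x) * G (F x) (\<eta> x) (h X (e i) x))
      - (\<Sum>i\<in>{1..n}. G (F x) (\<xi> x) (h X (e i) x) * G (F x) (\<eta> x) (h Y (e i) x))"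
    unfolding second[OF sm(1,2)] second[OF sm(2,1)] third by (simp add: metric_simps Fx)
  finally show ?thesis unfolding nabla_curvature[OF x diff[OF sm(1)] diff[OF sm(2)] sm(3)] .
qed

end

section \<open>The inequality in an adapted frame\<close>

lemma sum_pairs_swap:
  "(\<Sum>r\<in>R. \<Sum>s\<in>S. \<Sum>i\<in>I. \<Sum>j\<in>J. f r s i j) = (\<Sum>i\<in>I. \<Sum>j\<in>J. \<Sum>r\<in>R. \<Sum>s\<in>S. f r s i j)"
proof -
  have pull: "(\<Sum>s\<in>S. \<Sum>i\<in>I. \<Sum>j\<in>J. h s i j) = (\<Sum>i\<in>I. \<Sum>j\<in>J. \<Sum>s\<in>S. h s i j)" for h S
    unfolding sum.swap[of _ I S] by (rule sum.cong[OF refl]) (rule sum.swap)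
  show ?thesis unfolding pull ..
qed

text \<open>The commutator inequality for arrays of numbers. Indices are transported to finite types; if the
  type for the normal index has more than \<open>m\<close> elements, the tuple is padded with zero matrices.\<close>

theorem ddvv_inequality:
  fixes a :: "nat \<Rightarrow> nat \<Rightarrow> nat \<Rightarrow> real"
  assumes n: "CARD('n::finite) = n" and m: "m \<le> CARD('m::finite)"
    and sym: "\<And>r i j. a r i j = a r j i"
  shows "(\<Sum>i\<in>{1..n}. \<Sum>j\<in>{1..n}. \<Sum>r\<in>{1..m}. \<Sum>s\<in>{1..m}.
      (\<Sum>k\<in>{1..n}. a r i k * a s k j - a s i k * a r k j)\<^sup>2)
    \<le> (\<Sum>r\<in>{1..m}. \<Sum>i\<in>{1..n}. \<Sum>j\<in>{1..n}. (a r i j)\<^sup>2)\<^sup>2"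
proof -
  obtain p :: "'n \<Rightarrow> nat" where p: "bij_betw p UNIV {1..n}"
    using finite_same_card_bij[of "UNIV :: 'n set" "{1..n}"] n by auto
  obtain q :: "'m \<Rightarrow> nat" where q: "bij_betw q UNIV {1..CARD('m)}"
    using finite_same_card_bij[of "UNIV :: 'm set" "{1..CARD('m)}"] by auto
  have sp: "(\<Sum>i\<in>UNIV. f (p i)) = (\<Sum>i\<in>{1..n}. f i)" for f :: "nat \<Rightarrow> real"
    by (rule sum.reindex_bij_betw[OF p])
  have sq: "(\<Sum>r\<in>UNIV. f (q r)) = (\<Sum>r\<in>{1..m}. f r)" if "\<And>r. \<not> r \<le> m \<Longrightarrow> f r = 0" for f :: "nat \<Rightarrow> real"
  proof -
    have "(\<Sum>r\<in>UNIV. f (q r)) = (\<Sum>r\<in>{1..CARD('m)}. f r)" by (rule sum.reindex_bij_betw[OF q])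
    also have "\<dots> = (\<Sum>r\<in>{1..m}. f r)"
      by (rule sum.mono_neutral_right) (use m that in auto)
    finally show ?thesis .
  qed
  define a' where "a' r i j = (if r \<le> m then a r i j else 0)" for r i j
  define A :: "real^'n^'n^'m" where "A = (\<chi> r i j. a' (q r) (p i) (p j))"
  have Ac: "A $ r $ i $ j = a' (q r) (p i) (p j)" for r i j by (simp add: A_def)
  have "transpose (A $ r) = A $ r" for r
    using sym by (simp add: transpose_def vec_eq_iff Ac a'_def)
  then have le: "commutator_energy A \<le> ((norm A)\<^sup>2)\<^sup>2" by (rule commutator_energy_le)
  have norm2: "(norm (X :: real^'n^'n))\<^sup>2 = (\<Sum>i\<in>UNIV. \<Sum>j\<in>UNIV. (X $ i $ j)\<^sup>2)" for X
    unfolding power2_norm_eq_inner by (simp add: inner_vec_def power2_eq_square)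
  let ?C = "\<lambda>r s i j. \<Sum>k\<in>{1..n}. a' r i k * a' s k j - a' s i k * a' r k j"
  have "commutator (A $ r) (A $ s) $ i $ j = ?C (q r) (q s) (p i) (p j)" for r s i j
  proof -
    have "?C (q r) (q s) (p i) (p j) = (\<Sum>k\<in>UNIV. a' (q r) (p i) (p k) * a' (q s) (p k) (p j)
        - a' (q s) (p i) (p k) * a' (q r) (p k) (p j))"
      by (rule sp[symmetric])
    then show ?thesis by (simp only: commutator_def matrix_matrix_mult_def vector_minus_component
          vec_lambda_beta Ac sum_subtractf)
  qed
  then have "(norm (commutator (A $ r) (A $ s)))\<^sup>2
      = (\<Sum>i\<in>{1..n}. \<Sum>j\<in>{1..n}. (?C (q r) (q s) i j)\<^sup>2)" for r s
    unfolding norm2 by (simp only: sp[of "\<lambda>j. (?C _ _ _ j)\<^sup>2"] sp[of "\<lambda>i. \<Sum>j\<in>{1..n}. (?C _ _ i j)\<^sup>2"])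
  then have "commutator_energy A = (\<Sum>r\<in>UNIV. \<Sum>s\<in>UNIV. \<Sum>i\<in>{1..n}. \<Sum>j\<in>{1..n}. (?C (q r) (q s) i j)\<^sup>2)"
    by (simp add: commutator_energy_def)
  also have "\<dots> = (\<Sum>r\<in>UNIV. \<Sum>s\<in>{1..m}. \<Sum>i\<in>{1..n}. \<Sum>j\<in>{1..n}. (?C (q r) s i j)\<^sup>2)"
    by (intro sum.cong refl sq) (simp add: a'_def)
  also have "\<dots> = (\<Sum>r\<in>{1..m}. \<Sum>s\<in>{1..m}. \<Sum>i\<in>{1..n}. \<Sum>j\<in>{1..n}. (?C r s i j)\<^sup>2)"
    by (intro sq) (simp add: a'_def)
  also have "\<dots> = (\<Sum>i\<in>{1..n}. \<Sum>j\<in>{1..n}. \<Sum>r\<in>{1..m}. \<Sum>s\<in>{1..m}. (?C r s i j)\<^sup>2)"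
    by (rule sum_pairs_swap)
  also have "\<dots> = (\<Sum>i\<in>{1..n}. \<Sum>j\<in>{1..n}. \<Sum>r\<in>{1..m}. \<Sum>s\<in>{1..m}.
      (\<Sum>k\<in>{1..n}. a r i k * a s k j - a s i k * a r k j)\<^sup>2)"
    by (intro sum.cong refl arg_cong[where f = "\<lambda>t. t\<^sup>2"]) (simp add: a'_def)
  finally have energy: "commutator_energy A = \<dots>" .
  have "(norm A)\<^sup>2 = (\<Sum>r\<in>UNIV. (norm (A $ r))\<^sup>2)"
    by (simp add: norm_tuple power2_norm_eq_inner)
  also have "\<dots> = (\<Sum>r\<in>UNIV. \<Sum>i\<in>{1..n}. \<Sum>j\<in>{1..n}. (a' (q r) i j)\<^sup>2)"
    unfolding norm2 Ac by (simp only: sp[of "\<lambda>j. (a' _ _ j)\<^sup>2"] sp[of "\<lambda>i. \<Sum>j\<in>{1..n}. (a' _ i j)\<^sup>2"])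
  also have "\<dots> = (\<Sum>r\<in>{1..m}. \<Sum>i\<in>{1..n}. \<Sum>j\<in>{1..n}. (a' r i j)\<^sup>2)"
    by (intro sq) (simp add: a'_def)
  also have "\<dots> = (\<Sum>r\<in>{1..m}. \<Sum>i\<in>{1..n}. \<Sum>j\<in>{1..n}. (a r i j)\<^sup>2)"
    by (intro sum.cong refl) (simp add: a'_def)
  finally show ?thesis using le energy by simp
qed

lemma sum_upper_triangle:
  fixes f :: "nat \<Rightarrow> nat \<Rightarrow> real"
  assumes sym: "\<And>i j. f i j = f j i"
  shows "2 * (\<Sum>i\<in>{1..n}. \<Sum>j\<in>{i<..n}. f i j) = (\<Sum>i\<in>{1..n}. \<Sum>j\<in>{1..n}. f i j) - (\<Sum>i\<in>{1..n}. f i i)"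
proof (induction n)
  case (Suc n)
  have "(\<Sum>j\<in>{i<..Suc n}. f i j) = (\<Sum>j\<in>{i<..n}. f i j) + f i (Suc n)" if "i \<in> {1..n}" for i
  proof -
    have "{i<..Suc n} = insert (Suc n) {i<..n}" using that by auto
    then show ?thesis by simp
  qed
  then have "(\<Sum>i\<in>{1..Suc n}. \<Sum>j\<in>{i<..Suc n}. f i j)
      = (\<Sum>i\<in>{1..n}. \<Sum>j\<in>{i<..n}. f i j) + (\<Sum>i\<in>{1..n}. f i (Suc n))"
    by (simp add: sum.distrib)
  moreover have "(\<Sum>j\<in>{1..n}. f (Suc n) j) = (\<Sum>j\<in>{1..n}. f j (Suc n))"
    by (rule sum.cong[OF refl sym])
  then have "(\<Sum>i\<in>{1..Suc n}. \<Sum>j\<in>{1..Suc n}. f i j)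
      = (\<Sum>i\<in>{1..n}. \<Sum>j\<in>{1..n}. f i j) + 2 * (\<Sum>i\<in>{1..n}. f i (Suc n)) + f (Suc n) (Suc n)"
    by (simp add: sum.distrib)
  ultimately show ?case using Suc.IH by simp
qed simp

context framed_immersion
begin

text \<open>The Gauss equation gives \<open>2 \<Sum>\<^sub>i\<^sub><\<^sub>j K\<^sub>i\<^sub>j = n (n - 1) c + n\<^sup>2 |H|\<^sup>2 - Q\<close> with \<open>Q = \<Sum>\<^sub>i\<^sub>j |h\<^sub>i\<^sub>j|\<^sup>2\<close>, and the Ricci
  equation with the commutator inequality bounds twice the root of the normal sum by \<open>\<Sum> b\<^sup>2\<close>. The two
  are compared through the traceless part \<open>k\<close> of \<open>h\<close>: Bessel's inequality for the normal frame gives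
  \<open>\<Sum> b\<^sup>2 \<le> \<Sum>\<^sub>i\<^sub>j |k\<^sub>i\<^sub>j|\<^sup>2 = Q - n |H|\<^sup>2\<close>.\<close>

theorem normal_scalar_curvature_inequality:
  assumes n2: "n \<ge> 2" and m: "m \<le> DIM('f)"
    and x: "x \<in> W" and nf: "normal_frame_on m W G F \<xi>"
    and sec: "\<And>u v. u \<noteq> v \<Longrightarrow> independent {u, v} \<Longrightarrow> sectional_curvature G (F x) u v = c"
  shows "norm_scalar_curvature n g e x + norm_normal_scalar_curvature n m G F e \<xi> x
    \<le> G (F x) (mean_curvature n G F e x) (mean_curvature n G F e x) + c"
proof -
  let ?I = "{1..n}" and ?R = "{1..m}"
  have Fx: "F x \<in> U" using x by (rule maps)
  define ip where "ip = G (F x)"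
  \<comment> \<open>The value 0 for indices outside the frame makes the symmetry \<open>h i j = h j i\<close> unconditional.\<close>
  define h where "h i j = (if i \<in> ?I \<and> j \<in> ?I then second_fundamental_form G F (e i) (e j) x else 0)" for i j
  define H where "H = mean_curvature n G F e x"
  define k where "k i j = h i j - (if i = j then H else 0)" for i j
  define B where "B r i j = ip (h i j) (\<xi> r x)" for r i j
  define b where "b r i j = ip (k i j) (\<xi> r x)" for r i j
  note ips = metric_simps[OF Fx, folded ip_def]
  have ipsym: "ip u v = ip v u" for u v unfolding ip_def by (rule metric_sym[OF Fx])
  have nI: "real n > 0" "real n - 1 > 0" using n2 by auto
  have hsym: "h i j = h j i" for i j
    by (simp add: h_def second_fundamental_form_sym[OF x frame_differentiable[OF _ x] frame_differentiable[OF _ x]])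
  have ksym: "k i j = k j i" for i j by (simp add: k_def hsym)
  have riem: "G (F x) (riemann (F x) u v w) z = c * (ip v w * ip u z - ip u w * ip v z)" for u v w z
    unfolding ip_def by (rule riemann_constant_curvature[OF Fx sec])
  have ee: "ip (push (e i) x) (push (e j) x) = (if i = j then 1 else 0)" if "i \<in> ?I" "j \<in> ?I" for i j
    using frame_orthonormal[OF x that] by (simp add: ip_def isometry[OF x])
  have \<xi>s: "smooth_on W (\<xi> r)" and \<xi>n: "y \<in> W \<Longrightarrow> is_normal G F y (\<xi> r y)" if "r \<in> ?R" for r y
    using nf that by (auto simp: normal_frame_on_def)
  have \<xi>o: "ip (\<xi> r x) (\<xi> s x) = (if r = s then 1 else 0)" if "r \<in> ?R" "s \<in> ?R" for r s
    using nf that x by (simp add: normal_frame_on_def ip_def)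
  define Q where "Q = (\<Sum>i\<in>?I. \<Sum>j\<in>?I. ip (h i j) (h i j))"

  have H: "(\<Sum>i\<in>?I. h i i) = real n *\<^sub>R H"
    using nI by (simp add: H_def mean_curvature_def h_def)
  have gauss: "curvature g (e i) (e j) (e j) (e i) x = c + ip (h i i) (h j j) - ip (h i j) (h i j)"
    if "i \<in> ?I" "j \<in> {i<..n}" for i j
  proof -
    have j: "j \<in> ?I" and ij: "i \<noteq> j" using that by auto
    have "curvature g (e i) (e j) (e j) (e i) x = c + ip (h j j) (h i i) - ip (h i j) (h j i)"
      unfolding gauss_equation[OF x frame_smooth[OF that(1)] frame_smooth[OF j] frame_smooth[OF j] frame_smooth[OF that(1)]]
        riem using that j ij by (simp add: ee h_def ip_def[symmetric])
    then show ?thesis by (simp add: hsym[of j i] ipsym[of "h j j"])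
  qed
  have scalar: "2 * (\<Sum>i\<in>?I. \<Sum>j\<in>{i<..n}. curvature g (e i) (e j) (e j) (e i) x)
      = real n * (real n - 1) * c + (real n)\<^sup>2 * ip H H - Q"
  proof -
    let ?f = "\<lambda>i j. c + ip (h i i) (h j j) - ip (h i j) (h i j)"
    have "2 * (\<Sum>i\<in>?I. \<Sum>j\<in>{i<..n}. curvature g (e i) (e j) (e j) (e i) x) = 2 * (\<Sum>i\<in>?I. \<Sum>j\<in>{i<..n}. ?f i j)"
      by (intro arg_cong[where f = "(*) 2"] sum.cong refl) (rule gauss)
    also have "\<dots> = (\<Sum>i\<in>?I. \<Sum>j\<in>?I. ?f i j) - (\<Sum>i\<in>?I. ?f i i)"
      by (rule sum_upper_triangle) (simp add: hsym ipsym)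
    also have "(\<Sum>i\<in>?I. ?f i i) = real n * c" by simp
    also have "(\<Sum>i\<in>?I. \<Sum>j\<in>?I. ?f i j) = (real n)\<^sup>2 * c + ip (\<Sum>i\<in>?I. h i i) (\<Sum>j\<in>?I. h j j) - Q"
    proof -
      have "ip (\<Sum>i\<in>?I. h i i) (\<Sum>j\<in>?I. h j j) = (\<Sum>i\<in>?I. \<Sum>j\<in>?I. ip (h i i) (h j j))"
        unfolding ips(10) ips(9) by (rule sum.swap)
      then show ?thesis by (simp add: sum.distrib sum_subtractf Q_def power2_eq_square)
    qed
    also have "ip (\<Sum>i\<in>?I. h i i) (\<Sum>j\<in>?I. h j j) = (real n)\<^sup>2 * ip H H"
      unfolding H by (simp add: ips power2_eq_square)
    finally show ?thesis by (simp add: algebra_simps power2_eq_square)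
  qed
  have traceless: "(\<Sum>i\<in>?I. \<Sum>j\<in>?I. ip (k i j) (k i j)) = Q - real n * ip H H"
  proof -
    have "ip (k i j) (k i j) = ip (h i j) (h i j) + (if i = j then ip H H - 2 * ip (h i i) H else 0)" for i j
      by (simp add: k_def ips ipsym[of H "h _ _"])
    then have "(\<Sum>i\<in>?I. \<Sum>j\<in>?I. ip (k i j) (k i j)) = Q + (\<Sum>i\<in>?I. ip H H - 2 * ip (h i i) H)"
      by (simp add: sum.distrib Q_def)
    also have "(\<Sum>i\<in>?I. ip H H - 2 * ip (h i i) H) = real n * ip H H - 2 * ip (\<Sum>i\<in>?I. h i i) H"
      by (simp add: ips sum_subtractf sum_distrib_left)
    also have "\<dots> = - (real n * ip H H)" unfolding H by (simp add: ips)
    finally show ?thesis by simp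
  qed
  define C where "C r s i j = (\<Sum>l\<in>?I. b r i l * b s l j - b s i l * b r l j)" for r s i j
  have bsym: "b r i j = b r j i" for r i j by (simp add: b_def ksym)
  have ricci: "(G (F x) (normal_curvature_op G F (e i) (e j) (\<xi> r) x) (\<xi> s x))\<^sup>2 = (C r s i j)\<^sup>2"
    if "i \<in> ?I" "j \<in> ?I" "r \<in> ?R" "s \<in> ?R" for i j r s
  proof -
    have bB: "b r i j = B r i j - (if i = j then ip H (\<xi> r x) else 0)" for r i j
      by (simp add: b_def B_def k_def ips)
    have Bsym: "B r i j = B r j i" for r i j by (simp add: B_def hsym)
    \<comment> \<open>The correction terms are symmetric in \<open>r\<close> and \<open>s\<close> and drop out of the commutator.\<close>
    have prod: "(\<Sum>l\<in>?I. b r i l * b s l j) = (\<Sum>l\<in>?I. B r i l * B s l j)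
        - (ip H (\<xi> s x) * B r i j + ip H (\<xi> r x) * B s i j)
        + (if i = j then ip H (\<xi> r x) * ip H (\<xi> s x) else 0)" for r s
    proof -
      have "b r i l * b s l j = B r i l * B s l j
        - ((if l = j then ip H (\<xi> s x) * B r i j else 0) + (if l = i then ip H (\<xi> r x) * B s i j else 0))
        + (if l = i then (if i = j then ip H (\<xi> r x) * ip H (\<xi> s x) else 0) else 0)" for l
        by (auto simp: bB algebra_simps)
      then show ?thesis using that by (simp add: sum.distrib sum_subtractf)
    qed
    have t: "ip (push (e i) x) (\<xi> r x) = 0" if "r \<in> ?R" for i r
      using \<xi>n[OF that x] by (simp add: is_normal_def ip_def metric_sym[OF Fx, of "deriv_at F x _"])
    have "G (F x) (normal_curvature_op G F (e i) (e j) (\<xi> r) x) (\<xi> s x)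
        = (\<Sum>l\<in>?I. B r j l * B s i l) - (\<Sum>l\<in>?I. B r i l * B s j l)"
    proof -
      have "G (F x) (normal_curvature_op G F (e i) (e j) (\<xi> r) x) (\<xi> s x)
        = G (F x) (riemann (F x) (push (e i) x) (push (e j) x) (\<xi> r x)) (\<xi> s x)
          + (\<Sum>l\<in>?I. G (F x) (\<xi> r x) (second_fundamental_form G F (e j) (e l) x)
              * G (F x) (\<xi> s x) (second_fundamental_form G F (e i) (e l) x))
          - (\<Sum>l\<in>?I. G (F x) (\<xi> r x) (second_fundamental_form G F (e i) (e l) x)
              * G (F x) (\<xi> s x) (second_fundamental_form G F (e j) (e l) x))"
        by (rule ricci_equation[OF x frame_smooth[OF that(1)] frame_smooth[OF that(2)]
              \<xi>s[OF that(3)] \<xi>s[OF that(4)]]) (use \<xi>n that in auto)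
      then show ?thesis
        unfolding riem using that by (simp add: t B_def h_def ip_def[symmetric] ipsym[of "\<xi> _ x"])
    qed
    also have "\<dots> = (\<Sum>l\<in>?I. B s i l * B r l j) - (\<Sum>l\<in>?I. B r i l * B s l j)"
      by (simp add: Bsym mult.commute)
    also have "\<dots> = - C r s i j"
      unfolding C_def sum_subtractf prod by (auto simp: algebra_simps)
    finally show ?thesis by simp
  qed
  have normal: "4 * (\<Sum>i\<in>?I. \<Sum>j\<in>{i<..n}. \<Sum>r\<in>?R. \<Sum>s\<in>{r<..m}.
       (G (F x) (normal_curvature_op G F (e i) (e j) (\<xi> r) x) (\<xi> s x))\<^sup>2)
      = (\<Sum>i\<in>?I. \<Sum>j\<in>?I. \<Sum>r\<in>?R. \<Sum>s\<in>?R. (C r s i j)\<^sup>2)" (is "4 * ?N = _")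
  proof -
    have sw: "C s r i j = - C r s i j" for r s i j
      unfolding C_def sum_negf[symmetric] by (intro sum.cong refl) simp
    have tr: "C r s j i = - C r s i j" for r s i j
      unfolding C_def sum_negf[symmetric]
      by (intro sum.cong refl) (simp add: bsym mult.commute)
    let ?D = "\<lambda>i j. \<Sum>r\<in>?R. \<Sum>s\<in>{r<..m}. (C r s i j)\<^sup>2"
    have D: "2 * ?D i j = (\<Sum>r\<in>?R. \<Sum>s\<in>?R. (C r s i j)\<^sup>2)" for i j
    proof -
      have "C r r i j = 0" for r by (simp add: C_def)
      then show ?thesis
        using sum_upper_triangle[of "\<lambda>r s. (C r s i j)\<^sup>2" m] sw by (metis (no_types, lifting) power2_minus
            diff_zero power_zero_numeral sum.neutral)
    qed
    have "?N = (\<Sum>i\<in>?I. \<Sum>j\<in>{i<..n}. ?D i j)"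
      by (intro sum.cong refl) (rule ricci; auto)
    moreover have "2 * (\<Sum>i\<in>?I. \<Sum>j\<in>{i<..n}. ?D i j) = (\<Sum>i\<in>?I. \<Sum>j\<in>?I. ?D i j)"
    proof -
      have "C r s i i = 0" for r s i using tr[of r s i i] by simp
      moreover have "?D i j = ?D j i" for i j by (simp add: tr[of _ _ i j])
      ultimately show ?thesis using sum_upper_triangle[of ?D n] by simp
    qed
    ultimately have "4 * ?N = 2 * (\<Sum>i\<in>?I. \<Sum>j\<in>?I. ?D i j)" by linarith
    also have "\<dots> = (\<Sum>i\<in>?I. \<Sum>j\<in>?I. 2 * ?D i j)" by (simp only: sum_distrib_left)
    finally have "4 * ?N = (\<Sum>i\<in>?I. \<Sum>j\<in>?I. 2 * ?D i j)" .
    then show ?thesis unfolding D .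
  qed
  let ?K = "\<Sum>r\<in>?R. \<Sum>i\<in>?I. \<Sum>j\<in>?I. (b r i j)\<^sup>2"
  have "4 * ?N \<le> ?K\<^sup>2"
    unfolding normal C_def
    by (rule ddvv_inequality[where 'n = "'e basis_index" and 'm = "'f basis_index"])
       (simp_all add: CARD_basis_index dim m bsym)
  then have "sqrt (4 * ?N) \<le> sqrt (?K\<^sup>2)" by (rule real_sqrt_le_mono)
  moreover have "?K \<ge> 0" by (intro sum_nonneg) simp
  ultimately have sN: "2 * sqrt ?N \<le> ?K" by (simp add: real_sqrt_mult)
  have "?K = (\<Sum>i\<in>?I. \<Sum>r\<in>?R. \<Sum>j\<in>?I. (b r i j)\<^sup>2)" by (rule sum.swap)
  also have "\<dots> = (\<Sum>i\<in>?I. \<Sum>j\<in>?I. \<Sum>r\<in>?R. (b r i j)\<^sup>2)"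
    by (rule sum.cong[OF refl]) (rule sum.swap)
  also have "\<dots> \<le> (\<Sum>i\<in>?I. \<Sum>j\<in>?I. ip (k i j) (k i j))"
    unfolding b_def ip_def
    by (intro sum_mono bessel_inequality[OF Fx]) (use \<xi>o in \<open>simp_all add: ip_def\<close>)
  finally have K: "?K \<le> Q - real n * ip H H" unfolding traceless .
  let ?d = "real n * (real n - 1)"
  have d: "?d > 0" using nI by simp
  let ?S = "\<Sum>i\<in>?I. \<Sum>j\<in>{i<..n}. curvature g (e i) (e j) (e j) (e i) x"
  have "2 * ?S + 2 * sqrt ?N \<le> ?d * (ip H H + c)"
    using scalar sN K by (simp add: algebra_simps power2_eq_square)
  then have "(2 * ?S + 2 * sqrt ?N) / ?d \<le> ip H H + c"
    using d by (simp add: divide_le_eq mult.commute)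
  then show ?thesis
    unfolding norm_scalar_curvature_def norm_normal_scalar_curvature_def H_def ip_def
    by (simp add: add_divide_distrib)
qed

end

lemma metric_on_subset: "metric_on S g \<Longrightarrow> T \<subseteq> S \<Longrightarrow> metric_on T g"
  unfolding metric_on_def using smooth_on_subset by blast

lemma chart_inv_chart_map:
  assumes "is_chart M \<phi>" "p \<in> chart_dom \<phi>"
  shows "chart_inv \<phi> (chart_map \<phi> p) = p"
proof -
  have "inj_on (chart_map \<phi>) (chart_dom \<phi>)"
    using assms homeomorphic_imp_injective_map openin_subset
    unfolding is_chart_def by (metis inf.absorb2 topspace_subtopology)
  then show ?thesis unfolding chart_inv_def using assms(2) by simp
qed

theorem mainTheorem1:
  fixes n m :: nat and c :: real
    and M :: "'p topology" and A :: "('p, 'e::euclidean_space) chart set"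
    and g :: "('p, 'e) chart \<Rightarrow> 'e metric"
    and N :: "'q topology" and B :: "('q, 'f::euclidean_space) chart set"
    and G :: "('q, 'f) chart \<Rightarrow> 'f metric"
    and f :: "'p \<Rightarrow> 'q" and p :: 'p
    and \<phi> :: "('p, 'e) chart" and \<psi> :: "('q, 'f) chart"
    and W :: "'e set" and e :: "nat \<Rightarrow> 'e \<Rightarrow> 'e" and \<xi> :: "nat \<Rightarrow> 'e \<Rightarrow> 'f"
  defines "F \<equiv> local_rep \<phi> \<psi> f" and "x \<equiv> chart_map \<phi> p"
  assumes "n \<ge> 2" and "m \<ge> 1"
    and "DIM('e) = n" and "DIM('f) = n + m"
    and "riemannian_manifold M A g"
    and "space_form N B G c"
    and "isometric_immersion M A g N B G f"
    and "p \<in> topspace M"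
    and "\<phi> \<in> A" and "p \<in> chart_dom \<phi>"
    and "\<psi> \<in> B" and "f p \<in> chart_dom \<psi>"
    and "open W" and "x \<in> W" and "W \<subseteq> local_rep_dom \<phi> \<psi> f"
    and "tangent_frame_on n W (g \<phi>) e"
    and "normal_frame_on m W (G \<psi>) F \<xi>"
  shows "norm_scalar_curvature n (g \<phi>) e x + norm_normal_scalar_curvature n m (G \<psi>) F e \<xi> x
    \<le> G \<psi> (F x) (mean_curvature n (G \<psi>) F e x) (mean_curvature n (G \<psi>) F e x) + c"
proof -
  interpret im: isometric_immersion M A g N B G f by fact
  interpret sf: space_form N B G c by fact
  let ?U = "chart_map \<psi> ` chart_dom \<psi>"
  have maps: "F y \<in> ?U" if y: "y \<in> W" for y
  proof -
    from y \<open>W \<subseteq> local_rep_dom \<phi> \<psi> f\<close> obtain q where q: "q \<in> chart_dom \<phi>" "f q \<in> chart_dom \<psi>" "y = chart_map \<phi> q"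
      by (auto simp: local_rep_dom_def)
    then have "F y = chart_map \<psi> (f q)"
      by (simp add: F_def local_rep_def chart_inv_chart_map[OF im.source.charts[OF \<open>\<phi> \<in> A\<close>]])
    then show ?thesis using q by simp
  qed
  have "W \<subseteq> chart_map \<phi> ` chart_dom \<phi>"
    using \<open>W \<subseteq> local_rep_dom \<phi> \<psi> f\<close> by (auto simp: local_rep_dom_def)
  then have gW: "metric_on W (g \<phi>)" using im.source.metric[OF \<open>\<phi> \<in> A\<close>] metric_on_subset by blast
  \<comment> \<open>In the coordinates of the two charts the hypotheses are those of the local theory.\<close>
  interpret fr: framed_immersion ?U "G \<psi>" W "g \<phi>" F n e
  proof
    show "open ?U" using im.target.charts[OF \<open>\<psi> \<in> B\<close>] by (simp add: is_chart_def)
    show "metric_on ?U (G \<psi>)" by (rule im.target.metric[OF \<open>\<psi> \<in> B\<close>])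
    show "open W" "DIM('e) = n" "tangent_frame_on n W (g \<phi>) e" by fact+
    show "metric_on W (g \<phi>)" by fact
    show "smooth_on W F"
      unfolding F_def using im.smooth[OF \<open>\<phi> \<in> A\<close> \<open>\<psi> \<in> B\<close>] \<open>W \<subseteq> local_rep_dom \<phi> \<psi> f\<close> by (rule smooth_on_subset)
    fix y u v assume y: "y \<in> W"
    then show "F y \<in> ?U" by (rule maps)
    show "g \<phi> y u v = G \<psi> (F y) (deriv_at F y u) (deriv_at F y v)"
      unfolding F_def using im.isometric[OF \<open>\<phi> \<in> A\<close> \<open>\<psi> \<in> B\<close>] y \<open>W \<subseteq> local_rep_dom \<phi> \<psi> f\<close> by blast
  qed
  show ?thesis
  proof (rule fr.normal_scalar_curvature_inequality)
    show "n \<ge> 2" "x \<in> W" "normal_frame_on m W (G \<psi>) F \<xi>" by fact+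
    show "m \<le> DIM('f)" using \<open>DIM('f) = n + m\<close> by simp
    show "sectional_curvature (G \<psi>) (F x) u v = c" if "u \<noteq> v" "independent {u, v}" for u v
      using sf.constant_curvature[OF \<open>\<psi> \<in> B\<close> maps[OF \<open>x \<in> W\<close>] that] .
  qed
qed

end
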